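(* Let $f:\mathbb{R}^d\to\mathbb{R}$ be $L_0$-Lipschitz continuous and $L$-smooth (not necessarily convex), with minimum value $f(x^* )>-\infty$. Run the deterministic one-point residual feedback algorithm from $x_1$ for $T$ iterations with smoothing parameter $\alpha>0$ and step size $\eta=\min\left\{\frac{\alpha}{4dL_0},\frac{1}{16dL}\right\}$. Then $$\frac1T\sum_{t=1}^T\mathbb{E}\big[\|\nabla f(x_t)\|^2\big]\le\frac{4(f(x_1)-f(x^* ))}{\eta T}+\frac{4L\alpha^2}{\eta T}+\frac{32dLL_0^2\eta}{T}+40\eta d^2L^3\alpha^2+2L^2\alpha^2 .$$
   Context: $\|\cdot\|$ is the Euclidean norm on $\mathbb{R}^d$, $d\ge1$. A function $f$ is $L_0$-Lipschitz continuous ($L_0>0$) if $|f(x)-f(y)|\le L_0\|x-y\|$ for all $x,y$; it is $L$-smooth ($L>0$) if it is differentiable and $\|\nabla f(x)-\nabla f(y)\|\le L\|x-y\|$ for all $x,y$. $x^*$ denotes a minimizer of $f$ over $\mathbb{R}^d$. Deterministic one-point residual feedback algorithm: given an initial point $x_1\in\mathbb{R}^d$, step size $\eta>0$, smoothing parameter $\alpha>0$ and iteration number $T$, set $x_0=x_1$, let $u_0,u_1,\dots,u_T$ be independent and uniformly distributed on the unit sphere of $\mathbb{R}^d$, and for $t=1,\dots,T$ put $$g_t=d\cdot\frac{f(x_t+\alpha u_t)-f(x_{t-1}+\alpha u_{t-1})}{\alpha}\,u_t,\qquad x_{t+1}=x_t-\eta g_t .$$ Expectations are over all the $u_t$. 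*)

theory Defs
  imports "HOL-Probability.Probability"
begin

definition gradient :: "('a::real_inner \<Rightarrow> real) \<Rightarrow> 'a \<Rightarrow> 'a" where
  "gradient f x = (THE D. GDERIV f x :> D)"

definition smooth_with :: "real \<Rightarrow> ('a::real_inner \<Rightarrow> real) \<Rightarrow> bool" where
  "smooth_with L f \<longleftrightarrow>
     (\<forall>x. f differentiable (at x)) \<and>
     (\<forall>x y. norm (gradient f x - gradient f y) \<le> L * norm (x - y))"

lemma gradient_eqI:
  assumes "GDERIV f x :> D"
  shows "gradient f x = D"
  unfolding gradient_def
proof (rule the_equality)
  show "GDERIV f x :> D" by fact
next
  fix E assume "GDERIV f x :> E"
  with assms have "(\<lambda>h. inner h E) = (\<lambda>h. inner h D)"
    unfolding gderiv_def by (metis has_derivative_unique)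
  then have "inner (E - D) E = inner (E - D) D" by metis
  then have "inner (E - D) (E - D) = 0" by (simp add: inner_diff_right)
  then show "E = D" by simp
qed

lemma GDERIV_gradient:
  fixes f :: "'a::euclidean_space \<Rightarrow> real"
  assumes "f differentiable (at x)"
  shows "GDERIV f x :> gradient f x"
proof -
  from assms obtain F where F: "(f has_derivative F) (at x)"
    by (auto simp: differentiable_def)
  then interpret bounded_linear F by (rule has_derivative_bounded_linear)
  have "F h = inner h (adjoint F 1)" for h
    using adjoint_works[OF linear_axioms, of h 1] by simp
  then have "F = (\<lambda>h. inner h (adjoint F 1))" by blast
  with F have "GDERIV f x :> adjoint F 1" unfolding gderiv_def by simp
  then show ?thesis by (simp add: gradient_eqI)
qed

text \<open>
  The uniform distribution on the unit sphere is the normalised cone measure: a Borel set \<open>A\<close> of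
  unit vectors has as probability the fraction of the unit ball that is taken up by the cone
  \<open>{x. x / \<parallel>x\<parallel> \<in> A}\<close>.  This is the normalised surface measure, also in dimension one, where it is
  the uniform distribution on \<open>{-1, 1}\<close>.  The value \<open>sgn 0 = 0\<close> is taken on a null set only.
\<close>
definition uniform_sphere :: "'a::euclidean_space measure" where
  "uniform_sphere = distr (uniform_measure lborel (ball 0 1)) borel sgn"

lemma borel_measurable_sgn_euclidean [measurable]:
  "(sgn :: 'a::euclidean_space \<Rightarrow> 'a) \<in> borel_measurable borel"
  unfolding sgn_div_norm[abs_def] by measurable

lemma sets_uniform_sphere [simp, measurable_cong]: "sets uniform_sphere = sets borel"
  by (simp add: uniform_sphere_def)

lemma prob_space_uniform_ball:
  "prob_space (uniform_measure lborel (ball (0::'a::euclidean_space) 1))"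
proof (rule prob_space_uniform_measure)
  have "measure lborel (ball (0::'a) 1) > 0" by (simp add: content_ball_pos)
  then show "emeasure lborel (ball (0::'a) 1) \<noteq> 0" by (auto simp: measure_def)
  show "emeasure lborel (ball (0::'a) 1) \<noteq> \<infinity>"
    using emeasure_lborel_ball_finite[of "0::'a" 1] by simp
qed

lemma prob_space_uniform_sphere: "prob_space (uniform_sphere :: 'a::euclidean_space measure)"
  unfolding uniform_sphere_def
  by (intro prob_space.prob_space_distr prob_space_uniform_ball) simp

lemma AE_uniform_sphere: "AE u in (uniform_sphere :: 'a::euclidean_space measure). norm u = 1"
proof -
  have "AE x in lborel. (x::'a) \<noteq> 0" by (rule AE_lborel_singleton)
  then have "AE x in uniform_measure lborel (ball (0::'a) 1). norm (sgn x) = 1"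
    by (intro AE_uniform_measureI) (auto simp: norm_sgn)
  then show ?thesis
    unfolding uniform_sphere_def by (subst AE_distr_iff) auto
qed

text \<open>The sort constraint is the one of \<open>measure_orthogonal_image\<close>.\<close>
lemma uniform_sphere_orthogonal:
  fixes g :: "real ^ 'n::{finite,wellorder} \<Rightarrow> real ^ 'n::_"
  assumes g: "orthogonal_transformation g"
  shows "distr uniform_sphere borel g = uniform_sphere"
proof -
  interpret bounded_linear g
    using orthogonal_transformation_linear[OF g] by (simp add: linear_conv_bounded_linear)
  have bij: "bij g" by (rule orthogonal_transformation_bij[OF g])
  have meas [measurable]: "g \<in> borel_measurable borel"
    by (intro borel_measurable_continuous_onI linear_continuous_on bounded_linear_axioms)
  obtain h where h: "orthogonal_transformation h" and gh: "\<And>x. g (h x) = x" "\<And>x. h (g x) = x"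
    using orthogonal_transformation_inv[OF g] bij by (metis bij_inv_eq_iff)
  have sgn_g: "sgn (g x) = g (sgn x)" for x
    using orthogonal_transformation_norm[OF g] by (simp add: sgn_div_norm scaleR)
  have vim: "g -` A = h ` A" for A by (auto simp: gh image_iff) (metis gh(2))
  have lb: "distr lborel borel g = (lborel :: (real ^ 'n::_) measure)"
  proof (rule lborel_eqI[symmetric])
    fix l v :: "real ^ 'n::_"
    assume le: "\<And>b. b \<in> Basis \<Longrightarrow> l \<bullet> b \<le> v \<bullet> b"
    have box: "box l v \<in> lmeasurable" by simp
    have "g -` box l v \<in> sets borel" using meas by (rule measurable_sets_borel) simp
    then have hb: "h ` box l v \<in> sets lborel" by (simp add: vim)
    have "emeasure (distr lborel borel g) (box l v) = emeasure lborel (h ` box l v)"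
      by (subst emeasure_distr) (simp_all add: vim)
    also have "\<dots> = emeasure lebesgue (h ` box l v)" using hb by simp
    also have "\<dots> = ennreal (measure lebesgue (h ` box l v))"
      by (intro emeasure_eq_measure2 measurable_orthogonal_image h box)
    also have "\<dots> = ennreal (measure lebesgue (box l v))"
      by (simp add: measure_orthogonal_image[OF h box])
    also have "\<dots> = ennreal (\<Prod>b\<in>Basis. (v - l) \<bullet> b)"
      using le by (simp add: measure_lborel_box_eq)
    finally show "emeasure (distr lborel borel g) (box l v) = (\<Prod>b\<in>Basis. (v - l) \<bullet> b)" .
  qed simp
  have ball: "g -` A \<inter> ball 0 1 = g -` (A \<inter> ball 0 1)" for A
    using orthogonal_transformation_norm[OF g] by auto
  have um: "distr (uniform_measure lborel (ball 0 1)) borel g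
            = uniform_measure lborel (ball (0 :: real ^ 'n::_) 1)"
  proof (rule measure_eqI)
    fix A :: "(real ^ 'n::_) set"
    assume "A \<in> sets (distr (uniform_measure lborel (ball 0 1)) borel g)"
    then have A [measurable]: "A \<in> sets borel" by simp
    have gA: "g -` A \<in> sets borel" using meas A by (rule measurable_sets_borel)
    have "emeasure lborel (g -` (A \<inter> ball 0 1)) = emeasure (distr lborel borel g) (A \<inter> ball 0 1)"
      by (subst emeasure_distr) auto
    also have "\<dots> = emeasure lborel (A \<inter> ball 0 1)" by (simp add: lb)
    finally have *: "emeasure lborel (ball 0 1 \<inter> g -` A) = emeasure lborel (ball 0 1 \<inter> A)"
      by (simp only: ball[symmetric] Int_commute)
    show "emeasure (distr (uniform_measure lborel (ball 0 1)) borel g) A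
          = emeasure (uniform_measure lborel (ball 0 1)) A"
      using gA A by (subst emeasure_distr) (simp_all add: *)
  qed simp
  have "distr uniform_sphere borel g
        = distr (distr (uniform_measure lborel (ball 0 1)) borel g) borel sgn"
    unfolding uniform_sphere_def
    by (subst (1 2) distr_distr) (simp_all add: o_def sgn_g)
  then show ?thesis by (simp add: um uniform_sphere_def)
qed

definition residual_estimate ::
  "('a::euclidean_space \<Rightarrow> real) \<Rightarrow> real \<Rightarrow> 'a \<Rightarrow> 'a \<Rightarrow> 'a \<Rightarrow> 'a \<Rightarrow> 'a" where
  "residual_estimate f \<alpha> x u x' u' =
     (real DIM('a) * ((f (x + \<alpha> *\<^sub>R u) - f (x' + \<alpha> *\<^sub>R u')) / \<alpha>)) *\<^sub>R u"

text \<open>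
  \<open>residual_iterate f \<alpha> \<eta> x1 u t\<close> is the iterate \<open>x\<^sub>t\<close>, with \<open>x\<^sub>0 = x\<^sub>1\<close>, for a realisation \<open>u\<close> of the
  sampled directions.
\<close>
fun residual_iterate ::
  "('a::euclidean_space \<Rightarrow> real) \<Rightarrow> real \<Rightarrow> real \<Rightarrow> 'a \<Rightarrow> (nat \<Rightarrow> 'a) \<Rightarrow> nat \<Rightarrow> 'a" where
  "residual_iterate f \<alpha> \<eta> x1 u 0 = x1"
| "residual_iterate f \<alpha> \<eta> x1 u (Suc 0) = x1"
| "residual_iterate f \<alpha> \<eta> x1 u (Suc (Suc t)) =
     residual_iterate f \<alpha> \<eta> x1 u (Suc t) - \<eta> *\<^sub>R
       residual_estimate f \<alpha> (residual_iterate f \<alpha> \<eta> x1 u (Suc t)) (u (Suc t))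
                             (residual_iterate f \<alpha> \<eta> x1 u t) (u t)"

end

theory Submission
  imports Defs
begin

text \<open>
  Write \<open>g\<^sub>t\<close> for the estimate and \<open>x\<^sub>t\<close> for the iterate at time \<open>t\<close>. Since \<open>u\<^sub>t\<close> is independent of
  the past, the mean of \<open>g\<^sub>t\<close> given the past is \<open>(d / \<alpha>) E[f (x\<^sub>t + \<alpha> u) u]\<close>: the residual
  \<open>f (x\<^sub>t\<^sub>-\<^sub>1 + \<alpha> u\<^sub>t\<^sub>-\<^sub>1)\<close> is a constant that multiplies \<open>E[u] = 0\<close>. Everything rests on two facts about a
  single step from a fixed point \<open>x\<close>.

  The first fact is that this mean differs from the gradient at \<open>x\<close> by at most \<open>L \<alpha>\<close>, without a
  factor that depends on the dimension
  (\<open>integral_uniform_sphere_quadratic_bound\<close>). Classically this is the divergence theorem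
  on the ball. Here it comes from the rotation invariance of the sphere. Differentiating
  \<open>E[h (R u) (R u \<bullet> i)]\<close> along rotations \<open>R\<close> in the coordinate planes gives an integration by parts formula
  (\<open>integral_uniform_sphere_by_parts\<close>), and together with the derivative in the radius it
  turns into a differential equation: \<open>A r = E[h (r u) (u \<bullet> w)]\<close> satisfies
  \<open>(r\<^sup>d\<^sup>-\<^sup>1 A r)' = r\<^sup>d\<^sup>-\<^sup>1 E[\<nabla>h (r u) \<bullet> w]\<close>. Taking for \<open>h\<close> the error of the linear approximation of \<open>f\<close>
  at \<open>x\<close>, whose gradient at \<open>v\<close> has norm at most \<open>L \<parallel>v\<parallel>\<close>, and integrating gives the bound.

  The second fact is \<open>E[(u \<bullet> v)\<^sup>2] = \<parallel>v\<parallel>\<^sup>2 / d\<close>, from the same formula. It shows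
  that \<open>f (x + \<alpha> u) - f x\<close> has a second moment of order \<open>\<alpha>\<^sup>2 \<parallel>\<nabla>f x\<parallel>\<^sup>2 / d + L\<^sup>2 \<alpha>\<^sup>4\<close>
  (\<open>integral_sphere_increment_squared\<close>), which saves a factor \<open>d\<close> over the
  Cauchy-Schwarz inequality \<open>(u \<bullet> v)\<^sup>2 \<le> \<parallel>v\<parallel>\<^sup>2\<close>.

  Let \<open>D\<^sub>t\<close> and \<open>G\<^sub>t\<close> be the expectations of \<open>\<parallel>\<nabla>f x\<^sub>t\<parallel>\<^sup>2\<close> and \<open>\<parallel>g\<^sub>t\<parallel>\<^sup>2\<close>. The descent inequality for
  \<open>f\<close> itself and the first fact, in the form
  \<open>E[g\<^sub>t \<bullet> \<nabla>f x\<^sub>t] \<ge> (D\<^sub>t - L\<^sup>2 \<alpha>\<^sup>2) / 2\<close>, give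
  \<open>E[f x\<^sub>t\<^sub>+\<^sub>1] \<le> E[f x\<^sub>t] - \<eta> / 2 * (D\<^sub>t - L\<^sup>2 \<alpha>\<^sup>2) + L \<eta>\<^sup>2 / 2 * G\<^sub>t\<close>. Splitting the difference of function
  values in \<open>g\<^sub>t\<^sub>+\<^sub>1\<close> into the two sphere increments, at \<open>x\<^sub>t\<^sub>+\<^sub>1\<close> and at \<open>x\<^sub>t\<close>, and the change
  \<open>f x\<^sub>t\<^sub>+\<^sub>1 - f x\<^sub>t\<close>, which is at most \<open>L\<^sub>0 \<eta> \<parallel>g\<^sub>t\<parallel>\<close>, gives
  \<open>G\<^sub>t\<^sub>+\<^sub>1 \<le> G\<^sub>t / 4 + 3 d (D\<^sub>t\<^sub>+\<^sub>1 + D\<^sub>t) + 12 d\<^sup>2 L\<^sup>2 \<alpha>\<^sup>2\<close>; the condition \<open>4 d L\<^sub>0 \<eta> \<le> \<alpha>\<close> produces the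
  factor \<open>1 / 4\<close>. Summing the second recursion bounds the sum of the \<open>G\<^sub>t\<close> by \<open>8 d\<close> times the sum of the
  \<open>D\<^sub>t\<close> plus lower order terms, and as \<open>16 d L \<eta> \<le> 1\<close>, half of the sum of the \<open>D\<^sub>t\<close> is left over in the first
  one.
\<close>

section \<open>Rotation invariance of the uniform distribution on the sphere\<close>

text \<open>
  Fubini in the direction \<open>i\<close>: the inner integral is one-dimensional, so a shift along \<open>i\<close> whose
  length depends on the other coordinates can be undone slice by slice.
\<close>
lemma nn_integral_lborel_slice:
  fixes F :: "'a::euclidean_space \<Rightarrow> ennreal"
  assumes i: "i \<in> Basis" and [measurable]: "F \<in> borel_measurable borel"
  shows "(\<integral>\<^sup>+ x. F x \<partial>lborel) =
    (\<integral>\<^sup>+ x. \<integral>\<^sup>+ y. F (y *\<^sub>R i + (\<Sum>b\<in>Basis - {i}. x b *\<^sub>R b)) \<partial>lborel \<partial>(\<Pi>\<^sub>M b\<in>Basis - {i}. lborel))"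
proof -
  interpret product_sigma_finite "\<lambda>_::'a. lborel :: real measure" ..
  have ins: "insert i (Basis - {i}) = (Basis :: 'a set)" using i by auto
  have "(\<integral>\<^sup>+ x. F x \<partial>lborel) = (\<integral>\<^sup>+ x. F (\<Sum>b\<in>Basis. x b *\<^sub>R b) \<partial>(\<Pi>\<^sub>M b\<in>insert i (Basis - {i}). lborel))"
    unfolding ins by (subst lborel_eq) (simp add: nn_integral_distr)
  also have "\<dots> = (\<integral>\<^sup>+ x. \<integral>\<^sup>+ y. F (\<Sum>b\<in>Basis. (x(i := y)) b *\<^sub>R b) \<partial>lborel \<partial>(\<Pi>\<^sub>M b\<in>Basis - {i}. lborel))"
    by (subst product_nn_integral_insert) (auto simp: ins)
  also have "(\<lambda>x y. \<Sum>b\<in>Basis. (x(i := y)) b *\<^sub>R b)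
      = (\<lambda>x y. y *\<^sub>R i + (\<Sum>b\<in>Basis - {i}. x b *\<^sub>R b))"
    by (subst sum.remove[OF finite_Basis i]) simp
  finally show ?thesis .
qed

text \<open>
  On every line parallel to \<open>i\<close> the map is a translation, because \<open>\<phi>\<close> is constant along such a line.
\<close>
lemma lborel_distr_shear:
  fixes \<phi> :: "'a::euclidean_space \<Rightarrow> real"
  assumes i: "i \<in> Basis" and [measurable]: "\<phi> \<in> borel_measurable borel"
    and inv: "\<And>x s. \<phi> (s *\<^sub>R i + x) = \<phi> x"
  shows "distr lborel borel (\<lambda>x. x + \<phi> x *\<^sub>R i) = lborel"
proof (rule measure_eqI)
  fix A :: "'a set" assume "A \<in> sets (distr lborel borel (\<lambda>x. x + \<phi> x *\<^sub>R i))"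
  then have [measurable]: "A \<in> sets borel" by simp
  have shift: "(\<integral>\<^sup>+ y. indicator A (y *\<^sub>R i + S + \<phi> (y *\<^sub>R i + S) *\<^sub>R i) \<partial>lborel)
      = (\<integral>\<^sup>+ y. indicator A (y *\<^sub>R i + S) \<partial>lborel)" for S
    unfolding inv
    by (subst (2) nn_integral_real_affine[where c = 1 and t = "\<phi> S"])
      (simp_all add: algebra_simps)
  have "emeasure (distr lborel borel (\<lambda>x. x + \<phi> x *\<^sub>R i)) A
      = (\<integral>\<^sup>+ x. indicator A (x + \<phi> x *\<^sub>R i) \<partial>lborel)"
    by (subst nn_integral_indicator[symmetric], simp, subst nn_integral_distr) simp_all
  also have "\<dots> = (\<integral>\<^sup>+ x. indicator A x \<partial>lborel)"
    by (subst (1 2) nn_integral_lborel_slice[OF i]) (simp_all only: shift, measurable)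
  finally show "emeasure (distr lborel borel (\<lambda>x. x + \<phi> x *\<^sub>R i)) A = emeasure lborel A"
    by simp
qed simp

text \<open>
  A linear isometry commutes with \<open>sgn\<close> and preserves the unit ball, so the invariance of Lebesgue
  measure passes to the cone measure.
\<close>
lemma uniform_sphere_invariant:
  fixes g :: "'a::euclidean_space \<Rightarrow> 'a"
  assumes g: "linear g" and norm_g: "\<And>x. norm (g x) = norm x" and lb: "distr lborel borel g = lborel"
  shows "distr uniform_sphere borel g = uniform_sphere"
proof -
  have [measurable]: "g \<in> borel_measurable borel"
    by (intro borel_measurable_continuous_onI linear_continuous_on) (use g in \<open>simp add: linear_conv_bounded_linear\<close>)
  have sgn_g: "sgn (g x) = g (sgn x)" for x
    by (simp add: sgn_div_norm norm_g linear_cmul[OF g])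
  have "distr (uniform_measure lborel (ball 0 1)) borel g = uniform_measure lborel (ball (0::'a) 1)"
  proof (rule measure_eqI)
    fix A :: "'a set"
    assume "A \<in> sets (distr (uniform_measure lborel (ball 0 1)) borel g)"
    then have A [measurable]: "A \<in> sets borel" by simp
    have [measurable]: "g -` A \<in> sets borel" using measurable_sets_borel[of g borel A] by simp
    have "emeasure lborel (ball 0 1 \<inter> g -` A) = emeasure lborel (g -` (ball 0 1 \<inter> A))"
      by (rule arg_cong[where f = "emeasure lborel"]) (auto simp: norm_g)
    also have "\<dots> = emeasure (distr lborel borel g) (ball 0 1 \<inter> A)"
      by (subst emeasure_distr) auto
    finally show "emeasure (distr (uniform_measure lborel (ball 0 1)) borel g) A
        = emeasure (uniform_measure lborel (ball 0 1)) A"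
      by (subst emeasure_distr) (simp_all add: lb)
  qed simp
  then have "uniform_sphere = distr (distr (uniform_measure lborel (ball (0::'a) 1)) borel g) borel sgn"
    by (simp add: uniform_sphere_def)
  also have "\<dots> = distr uniform_sphere borel g"
    unfolding uniform_sphere_def by (subst (1 2) distr_distr) (simp_all add: o_def sgn_g)
  finally show ?thesis by simp
qed

lemma uniform_sphere_uminus: "distr uniform_sphere borel uminus = (uniform_sphere :: 'a::euclidean_space measure)"
proof (rule uniform_sphere_invariant)
  show "linear (uminus :: 'a \<Rightarrow> 'a)" by (rule linear_uminus)
  show "distr lborel borel uminus = (lborel :: 'a measure)"
    using lborel_affine[of "-1" "0::'a"]  by (simp add: density_1 cong: distr_cong)
qed simp

text \<open>
  The rotation by \<open>\<theta>\<close> in the plane of two orthonormal vectors \<open>i\<close> and \<open>j\<close>, as a perturbation of the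
  identity: only the components along \<open>i\<close> and \<open>j\<close> change.
\<close>
definition plane_rotation :: "'a::euclidean_space \<Rightarrow> 'a \<Rightarrow> real \<Rightarrow> 'a \<Rightarrow> 'a" where
  "plane_rotation i j \<theta> x =
     x + ((cos \<theta> - 1) * (x \<bullet> i) - sin \<theta> * (x \<bullet> j)) *\<^sub>R i + (sin \<theta> * (x \<bullet> i) + (cos \<theta> - 1) * (x \<bullet> j)) *\<^sub>R j"

lemma norm_plane_rotation:
  fixes i j :: "'a::euclidean_space"
  assumes ij: "i \<in> Basis" "j \<in> Basis" "i \<noteq> j"
  shows "norm (plane_rotation i j \<theta> x) = norm x"
proof -
  have "inner i i = 1" "inner j j = 1" "inner i j = 0" "inner j i = 0"
    using ij by (auto simp: inner_Basis)
  then have "plane_rotation i j \<theta> x \<bullet> plane_rotation i j \<theta> x =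
      x \<bullet> x + ((sin \<theta>)\<^sup>2 + (cos \<theta>)\<^sup>2 - 1) * ((x \<bullet> i)\<^sup>2 + (x \<bullet> j)\<^sup>2)"
    unfolding plane_rotation_def
    by (simp add: inner_add_left inner_add_right inner_commute[of i x] inner_commute[of j x]
        del: sin_cos_squared_add sin_cos_squared_add2 sin_cos_squared_add3)
      (simp add: algebra_simps power2_eq_square del: sin_cos_squared_add3)
  then show ?thesis by (simp add: norm_eq_sqrt_inner)
qed

lemma linear_plane_rotation: "linear (plane_rotation i j \<theta>)"
  by (rule linearI) (simp_all add: plane_rotation_def algebra_simps inner_simps)

text \<open>
  A plane rotation is a composition of three shears, along \<open>i\<close>, \<open>j\<close> and \<open>i\<close> again, with the factors
  \<open>- tan (\<theta> / 2)\<close>, \<open>sin \<theta>\<close> and \<open>- tan (\<theta> / 2)\<close>. The tangent is the reason for the bound on \<open>\<theta>\<close>.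
\<close>
lemma uniform_sphere_plane_rotation:
  fixes i j :: "'a::euclidean_space"
  assumes ij: "i \<in> Basis" "j \<in> Basis" "i \<noteq> j" and \<theta>: "\<bar>\<theta>\<bar> < pi"
  shows "distr uniform_sphere borel (plane_rotation i j \<theta>) = uniform_sphere"
proof (rule uniform_sphere_invariant[OF linear_plane_rotation norm_plane_rotation[OF ij]])
  have in_simps: "i \<bullet> i = 1" "j \<bullet> j = 1" "i \<bullet> j = 0" "j \<bullet> i = 0"
    using ij by (auto simp: inner_Basis)
  define S where "S = (\<lambda>x. x + (- tan (\<theta> / 2) * (x \<bullet> j)) *\<^sub>R i)"
  define S' where "S' = (\<lambda>x. x + (sin \<theta> * (x \<bullet> i)) *\<^sub>R j)"
  have [measurable]: "S \<in> borel_measurable borel" "S' \<in> borel_measurable borel"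
    unfolding S_def S'_def by measurable
  have S: "distr lborel borel S = lborel" unfolding S_def
    by (rule lborel_distr_shear) (use ij in \<open>auto simp: inner_simps in_simps\<close>)
  have S': "distr lborel borel S' = lborel" unfolding S'_def
    by (rule lborel_distr_shear) (use ij in \<open>auto simp: inner_simps in_simps\<close>)
  have "cos (\<theta> / 2) > 0" using \<theta> by (intro cos_gt_zero_pi) auto
  then have tan_sin: "tan (\<theta> / 2) * sin \<theta> = 1 - cos \<theta>"
    and tan_cos: "tan (\<theta> / 2) * (1 + cos \<theta>) = sin \<theta>"
    using sin_double[of "\<theta> / 2"] cos_double_sin[of "\<theta> / 2"] cos_double_cos[of "\<theta> / 2"]
    by (simp_all add: tan_def field_simps power2_eq_square)
  have eq: "plane_rotation i j \<theta> x = S (S' (S x))" for x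
  proof -
    \<comment> \<open>The coordinates along \<open>j\<close> after the second shear and along \<open>i\<close> after the third one.\<close>
    let ?t = "tan (\<theta> / 2)" and ?a = "x \<bullet> i" and ?b = "x \<bullet> j"
    have j_coord: "sin \<theta> * (?a - ?t * ?b) = sin \<theta> * ?a + (cos \<theta> - 1) * ?b"
      using tan_sin by algebra
    have i_coord: "- ?t * ?b - ?t * (?b + (sin \<theta> * ?a + (cos \<theta> - 1) * ?b)) = (cos \<theta> - 1) * ?a - sin \<theta> * ?b"
      using tan_sin tan_cos by algebra
    have "S (S' (S x)) = x + (- ?t * ?b - ?t * (?b + sin \<theta> * (?a - ?t * ?b))) *\<^sub>R i
        + (sin \<theta> * (?a - ?t * ?b)) *\<^sub>R j"
      by (simp add: S_def S'_def inner_simps in_simps algebra_simps) (simp add: scaleR_left_distrib[symmetric])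
    then show ?thesis unfolding j_coord i_coord plane_rotation_def by simp
  qed
  have "distr lborel borel (plane_rotation i j \<theta>) = distr (distr (distr lborel borel S) borel S') borel S"
    by (simp add: distr_distr o_def eq[abs_def])
  then show "distr lborel borel (plane_rotation i j \<theta>) = lborel" by (simp add: S S')
qed

section \<open>Calculus of spherical means\<close>

lemma AE_uniform_sphereI:
  fixes P :: "'a::euclidean_space \<Rightarrow> bool"
  assumes "\<And>u. norm u = 1 \<Longrightarrow> P u"
  shows "AE u in uniform_sphere. P u"
  using AE_uniform_sphere by eventually_elim (fact assms)

lemma integrable_uniform_sphere:
  fixes k :: "'a::euclidean_space \<Rightarrow> real"
  assumes "continuous_on UNIV k"
  shows "integrable uniform_sphere k"
proof -
  interpret prob_space "uniform_sphere :: 'a measure" by (rule prob_space_uniform_sphere)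
  have "compact (k ` sphere 0 1)"
    by (intro compact_continuous_image continuous_on_subset[OF assms]) auto
  then obtain B where "\<forall>y \<in> k ` sphere 0 1. norm y \<le> B"
    using bounded_iff[THEN iffD1, OF compact_imp_bounded] by blast
  then have "\<And>u. norm u = 1 \<Longrightarrow> norm (k u) \<le> B" by force
  then show ?thesis
    using borel_measurable_continuous_onI[OF assms]
    by (intro integrable_const_bound[where B = B] AE_uniform_sphereI) simp_all
qed

lemma integral_uniform_sphere_mono:
  fixes k l :: "'a::euclidean_space \<Rightarrow> real"
  assumes "continuous_on UNIV k" "continuous_on UNIV l" "\<And>u. norm u = 1 \<Longrightarrow> k u \<le> l u"
  shows "(LINT u|uniform_sphere. k u) \<le> (LINT u|uniform_sphere. l u)"
  by (intro integral_mono_AE integrable_uniform_sphere assms AE_uniform_sphereI)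

lemma integral_uniform_sphere_cong:
  fixes k l :: "'a::euclidean_space \<Rightarrow> real"
  assumes "continuous_on UNIV k" "continuous_on UNIV l" "\<And>u. norm u = 1 \<Longrightarrow> k u = l u"
  shows "(LINT u|uniform_sphere. k u) = (LINT u|uniform_sphere. l u)"
  by (intro integral_cong_AE AE_uniform_sphereI borel_measurable_integrable
      integrable_uniform_sphere assms)

lemma measure_space_uniform_sphere [simp]:
  "measure (uniform_sphere :: 'a::euclidean_space measure) (space uniform_sphere) = 1"
  by (rule prob_space.prob_space[OF prob_space_uniform_sphere])

text \<open>
  By the symmetry \<open>u \<mapsto> - u\<close>.
\<close>
lemma integral_uniform_sphere_inner:
  fixes w :: "'a::euclidean_space"
  shows "(LINT u|uniform_sphere. u \<bullet> w) = 0"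
proof -
  have "(LINT u|uniform_sphere. u \<bullet> w) = (LINT u|distr uniform_sphere borel uminus. u \<bullet> w)"
    by (simp add: uniform_sphere_uminus)
  also have "\<dots> = - (LINT u|uniform_sphere. u \<bullet> w)"
    by (subst integral_distr) auto
  finally show ?thesis by simp
qed

text \<open>
  Dominated convergence. Joint continuity bounds the derivative on the compact set of all
  \<open>(s, u)\<close> with \<open>\<bar>s - t\<bar> \<le> 1\<close> and \<open>\<parallel>u\<parallel> = 1\<close>, and by the mean value theorem the same constant bounds the
  difference quotients.
\<close>
lemma DERIV_integral_uniform_sphere:
  fixes F F' :: "real \<Rightarrow> 'a::euclidean_space \<Rightarrow> real"
  assumes deriv: "\<And>t u. ((\<lambda>t. F t u) has_real_derivative F' t u) (at t)"
    and contF: "\<And>t. continuous_on UNIV (F t)"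
    and contF': "continuous_on UNIV (\<lambda>(t, u). F' t u)"
  shows "((\<lambda>t. LINT u|uniform_sphere. F t u) has_real_derivative (LINT u|uniform_sphere. F' t u)) (at t)"
proof -
  interpret prob_space "uniform_sphere :: 'a measure" by (rule prob_space_uniform_sphere)
  define S where "S = {t - 1..t + 1}"
  have "compact ((\<lambda>(t, u). F' t u) ` (S \<times> sphere 0 1))"
    by (intro compact_continuous_image continuous_on_subset[OF contF'] compact_Times)
      (auto simp: S_def)
  then obtain B where "\<forall>y \<in> (\<lambda>(t, u). F' t u) ` (S \<times> sphere 0 1). norm y \<le> B"
    using bounded_iff[THEN iffD1, OF compact_imp_bounded] by blast
  then have B: "norm (F' s u) \<le> B" if "s \<in> S" "norm u = 1" for s u
    using that by force
  have contF't: "continuous_on UNIV (F' t)"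
  proof -
    have "continuous_on UNIV (\<lambda>u. (\<lambda>(t, u). F' t u) (t, u))"
      by (rule continuous_on_compose2[OF contF']) (auto intro!: continuous_intros)
    then show ?thesis by simp
  qed
  have lip: "norm (F s u - F t u) \<le> B * norm (s - t)" if "s \<in> S" "norm u = 1" for s u
    using that B
    by (intro field_differentiable_bound[where S = S and f' = "\<lambda>s. F' s u"] DERIV_subset[OF deriv])
      (auto simp: S_def)
  let ?I = "\<lambda>t. LINT u|uniform_sphere. F t u"
  have "((\<lambda>s. (?I s - ?I t) / (s - t)) \<longlongrightarrow> (LINT u|uniform_sphere. F' t u)) (at t within S)"
    unfolding tendsto_at_iff_sequentially o_def
  proof (intro allI impI)
    fix X :: "nat \<Rightarrow> real" assume X: "\<forall>n. X n \<in> S - {t}" "X \<longlonglongrightarrow> t"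
    have quot: "(?I (X n) - ?I t) / (X n - t) = (LINT u|uniform_sphere. (F (X n) u - F t u) / (X n - t))" for n
      by (simp add: integrable_uniform_sphere contF)
    have "(\<lambda>n. LINT u|uniform_sphere. (F (X n) u - F t u) / (X n - t)) \<longlonglongrightarrow> (LINT u|uniform_sphere. F' t u)"
    proof (rule integral_dominated_convergence[where w = "\<lambda>_. B"])
      show "AE u in uniform_sphere. (\<lambda>n. (F (X n) u - F t u) / (X n - t)) \<longlonglongrightarrow> F' t u"
      proof (intro always_eventually allI)
        fix u
        have "filterlim X (at t) sequentially" using X by (simp add: filterlim_at)
        with deriv[where t = t and u = u, unfolded has_field_derivative_iff]
        show "(\<lambda>n. (F (X n) u - F t u) / (X n - t)) \<longlonglongrightarrow> F' t u"
          by (rule filterlim_compose)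
      qed
      show "AE u in uniform_sphere. norm ((F (X n) u - F t u) / (X n - t)) \<le> B" for n
      proof (rule AE_uniform_sphereI)
        fix u :: 'a assume "norm u = 1"
        with lip[of "X n" u] X(1) show "norm ((F (X n) u - F t u) / (X n - t)) \<le> B"
          by (simp add: pos_divide_le_eq)
      qed
      show "F' t \<in> borel_measurable uniform_sphere"
        by (intro borel_measurable_integrable integrable_uniform_sphere contF't)
      show "(\<lambda>u. (F (X n) u - F t u) / (X n - t)) \<in> borel_measurable uniform_sphere" for n
        using X(1) by (intro borel_measurable_integrable integrable_uniform_sphere
            continuous_on_divide continuous_on_diff contF continuous_on_const) auto
    qed simp
    then show "(\<lambda>n. (?I (X n) - ?I t) / (X n - t)) \<longlonglongrightarrow> (LINT u|uniform_sphere. F' t u)"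
      by (simp add: quot)
  qed
  moreover have "at t within S = at t"
    unfolding S_def by (rule at_within_interior) auto
  ultimately show ?thesis by (simp add: has_field_derivative_iff)
qed

lemma DERIV_GDERIV_compose:
  assumes "GDERIV k (c t) :> D" "(c has_vector_derivative v) (at t)"
  shows "((\<lambda>t. k (c t)) has_real_derivative v \<bullet> D) (at t)"
  using has_derivative_compose[OF assms(2)[unfolded has_vector_derivative_def] assms(1)[unfolded gderiv_def]]
  by (rule has_derivative_imp_has_field_derivative) simp

lemma GDERIV_continuous_on:
  assumes "\<And>x. GDERIV k x :> Dk x"
  shows "continuous_on S k"
  by (intro continuous_at_imp_continuous_on ballI
      has_derivative_continuous[OF assms[unfolded gderiv_def]])

text \<open>
  The mean of \<open>k\<close> over the sphere does not change when \<open>k\<close> is composed with a rotation, so the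
  derivative with respect to the angle has mean zero.
\<close>
lemma integral_uniform_sphere_angular_derivative:
  fixes k :: "'a::euclidean_space \<Rightarrow> real"
  assumes deriv: "\<And>x. GDERIV k x :> Dk x" and cont: "continuous_on UNIV Dk"
    and ij: "i \<in> Basis" "j \<in> Basis" "i \<noteq> j"
  shows "(LINT u|uniform_sphere. (u \<bullet> i) * (Dk u \<bullet> j) - (u \<bullet> j) * (Dk u \<bullet> i)) = 0"
proof -
  define R where "R = plane_rotation i j"
  define R' where "R' = (\<lambda>\<theta> u. (- sin \<theta> * (u \<bullet> i) - cos \<theta> * (u \<bullet> j)) *\<^sub>R i
      + (cos \<theta> * (u \<bullet> i) - sin \<theta> * (u \<bullet> j)) *\<^sub>R j)"
  have R_deriv: "((\<lambda>\<theta>. R \<theta> u) has_vector_derivative R' \<theta> u) (at \<theta>)" for \<theta> u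
    unfolding R_def R'_def plane_rotation_def
    by (auto intro!: derivative_eq_intros simp: algebra_simps)
  have contk: "continuous_on UNIV k" by (rule GDERIV_continuous_on[OF deriv])
  have "((\<lambda>\<theta>. LINT u|uniform_sphere. k (R \<theta> u)) has_real_derivative
      (LINT u|uniform_sphere. R' 0 u \<bullet> Dk (R 0 u))) (at 0)"
  proof (rule DERIV_integral_uniform_sphere)
    show "((\<lambda>\<theta>. k (R \<theta> u)) has_real_derivative R' \<theta> u \<bullet> Dk (R \<theta> u)) (at \<theta>)" for \<theta> u
      by (rule DERIV_GDERIV_compose[OF deriv R_deriv])
    show "continuous_on UNIV (\<lambda>u. k (R \<theta> u))" for \<theta>
      unfolding R_def plane_rotation_def
      by (rule continuous_on_compose2[OF contk]) (auto intro!: continuous_intros)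
    show "continuous_on UNIV (\<lambda>(\<theta>, u). R' \<theta> u \<bullet> Dk (R \<theta> u))"
      unfolding case_prod_unfold R_def R'_def plane_rotation_def
      by (intro continuous_intros continuous_on_compose2[OF cont]) auto
  qed
  moreover have "((\<lambda>\<theta>. LINT u|uniform_sphere. k (R \<theta> u)) has_real_derivative 0) (at 0)"
  proof (rule has_field_derivative_transform_within_open[of "\<lambda>_. LINT u|uniform_sphere. k u" _ _ "{-pi<..<pi}"])
    fix \<theta> :: real assume "\<theta> \<in> {-pi<..<pi}"
    then have inv: "distr uniform_sphere borel (R \<theta>) = uniform_sphere"
      unfolding R_def by (intro uniform_sphere_plane_rotation ij) auto
    have [measurable]: "k \<in> borel_measurable borel" using contk by (rule borel_measurable_continuous_onI)
    have "(LINT u|uniform_sphere. k u) = (LINT u|distr uniform_sphere borel (R \<theta>). k u)"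
      by (simp add: inv)
    also have "\<dots> = (LINT u|uniform_sphere. k (R \<theta> u))"
      unfolding R_def plane_rotation_def by (rule integral_distr) measurable
    finally show "(LINT u|uniform_sphere. k u) = (LINT u|uniform_sphere. k (R \<theta> u))" .
  qed auto
  ultimately have "(LINT u|uniform_sphere. R' 0 u \<bullet> Dk (R 0 u)) = 0"
    by (rule DERIV_unique)
  moreover have "R' 0 u \<bullet> Dk (R 0 u) = (u \<bullet> i) * (Dk u \<bullet> j) - (u \<bullet> j) * (Dk u \<bullet> i)" for u
    by (simp add: R'_def R_def plane_rotation_def inner_add_left inner_diff_left inner_commute[of i "Dk u"] inner_commute[of j "Dk u"])
  ultimately show ?thesis by simp
qed

text \<open>
  Apply \<open>integral_uniform_sphere_angular_derivative\<close> to \<open>h u * (u \<bullet> i)\<close> for every \<open>i \<noteq> j\<close> and add up.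
  Each of the \<open>d - 1\<close> planes contributes one copy of \<open>h u * (u \<bullet> j)\<close>, from the derivative of the
  factor \<open>u \<bullet> i\<close>, and the derivatives of \<open>h\<close> add up to its tangential derivative in the
  direction \<open>j\<close> because \<open>\<parallel>u\<parallel> = 1\<close>.
\<close>
lemma integral_uniform_sphere_by_parts_Basis:
  fixes h :: "'a::euclidean_space \<Rightarrow> real"
  assumes deriv: "\<And>x. GDERIV h x :> Dh x" and cont: "continuous_on UNIV Dh" and j: "j \<in> Basis"
  shows "(real DIM('a) - 1) * (LINT u|uniform_sphere. h u * (u \<bullet> j))
    = (LINT u|uniform_sphere. Dh u \<bullet> j - (Dh u \<bullet> u) * (u \<bullet> j))"
proof -
  have conth: "continuous_on UNIV h" by (rule GDERIV_continuous_on[OF deriv])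
  \<comment> \<open>The integrand of the angular derivative for \<open>h u * (u \<bullet> i)\<close>; at \<open>i = j\<close> it is \<open>- h u * (u \<bullet> j)\<close>,
    so that completing the sum to all of \<open>Basis\<close> costs one such term.\<close>
  define q where "q = (\<lambda>i u. (u \<bullet> i)\<^sup>2 * (Dh u \<bullet> j) - (u \<bullet> j) * ((u \<bullet> i) * (Dh u \<bullet> i)) - h u * (u \<bullet> j))"
  have "(LINT u|uniform_sphere. q i u) = 0" if i: "i \<in> Basis - {j}" for i
  proof -
    have [simp]: "i \<bullet> i = 1" "i \<bullet> j = 0" using i j by (auto simp: inner_Basis)
    have "(LINT u|uniform_sphere. (u \<bullet> i) * (((u \<bullet> i) *\<^sub>R Dh u + h u *\<^sub>R i) \<bullet> j)
        - (u \<bullet> j) * (((u \<bullet> i) *\<^sub>R Dh u + h u *\<^sub>R i) \<bullet> i)) = 0"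
    proof (rule integral_uniform_sphere_angular_derivative)
      show "GDERIV (\<lambda>x. h x * (x \<bullet> i)) x :> (x \<bullet> i) *\<^sub>R Dh x + h x *\<^sub>R i" for x
        using deriv[of x] unfolding gderiv_def
        by (auto intro!: derivative_eq_intros simp: inner_simps)
    qed (use i j in \<open>auto intro!: continuous_intros cont conth\<close>)
    then show ?thesis
      by (simp add: q_def inner_add_left power2_eq_square algebra_simps)
  qed
  then have "0 = (\<Sum>i\<in>Basis - {j}. LINT u|uniform_sphere. q i u)" by simp
  also have "\<dots> = (LINT u|uniform_sphere. (\<Sum>i\<in>Basis - {j}. q i u))"
    unfolding q_def
    by (intro Bochner_Integration.integral_sum[symmetric] integrable_uniform_sphere continuous_intros cont conth)
  also have "\<dots> = (LINT u|uniform_sphere. (Dh u \<bullet> j - (Dh u \<bullet> u) * (u \<bullet> j)) - (real DIM('a) - 1) * (h u * (u \<bullet> j)))"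
  proof (rule integral_uniform_sphere_cong)
    fix u :: 'a assume u: "norm u = 1"
    have "(\<Sum>i\<in>Basis. (u \<bullet> i)\<^sup>2) = 1"
      using u by (simp add: norm_eq_1 euclidean_inner[of u u] power2_eq_square)
    moreover have "(\<Sum>i\<in>Basis. (u \<bullet> i) * (Dh u \<bullet> i)) = Dh u \<bullet> u"
      by (simp add: euclidean_inner[of "Dh u" u] mult.commute)
    moreover have "(\<Sum>i\<in>Basis - {j}. q i u) = (\<Sum>i\<in>Basis. q i u) - q j u"
      using j by (simp add: sum_diff1)
    moreover have "(\<Sum>i\<in>Basis. q i u) = (\<Sum>i\<in>Basis. (u \<bullet> i)\<^sup>2) * (Dh u \<bullet> j)
        - (u \<bullet> j) * (\<Sum>i\<in>Basis. (u \<bullet> i) * (Dh u \<bullet> i)) - real DIM('a) * (h u * (u \<bullet> j))"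
      by (simp add: q_def sum_subtractf sum_distrib_left sum_distrib_right)
    ultimately show "(\<Sum>i\<in>Basis - {j}. q i u)
        = (Dh u \<bullet> j - (Dh u \<bullet> u) * (u \<bullet> j)) - (real DIM('a) - 1) * (h u * (u \<bullet> j))"
      by (simp add: q_def algebra_simps power2_eq_square)
  qed (auto simp: q_def intro!: continuous_intros cont conth)
  also have "\<dots> = (LINT u|uniform_sphere. Dh u \<bullet> j - (Dh u \<bullet> u) * (u \<bullet> j))
      - (real DIM('a) - 1) * (LINT u|uniform_sphere. h u * (u \<bullet> j))"
    by (subst Bochner_Integration.integral_diff)
      (auto intro!: integrable_uniform_sphere continuous_intros cont conth)
  finally show ?thesis by simp
qed

lemma integral_uniform_sphere_by_parts:
  fixes h :: "'a::euclidean_space \<Rightarrow> real"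
  assumes deriv: "\<And>x. GDERIV h x :> Dh x" and cont: "continuous_on UNIV Dh"
  shows "(real DIM('a) - 1) * (LINT u|uniform_sphere. h u * (u \<bullet> w))
    = (LINT u|uniform_sphere. Dh u \<bullet> w - (Dh u \<bullet> u) * (u \<bullet> w))"
proof -
  have conth: "continuous_on UNIV h" by (rule GDERIV_continuous_on[OF deriv])
  have expand: "v \<bullet> w = (\<Sum>j\<in>Basis. (w \<bullet> j) * (v \<bullet> j))" for v
    by (simp add: euclidean_inner[of v w] mult.commute)
  have "(LINT u|uniform_sphere. h u * (u \<bullet> w))
      = (LINT u|uniform_sphere. (\<Sum>j\<in>Basis. (w \<bullet> j) * (h u * (u \<bullet> j))))"
    by (simp add: expand sum_distrib_left mult.left_commute)
  also have "\<dots> = (\<Sum>j\<in>Basis. (w \<bullet> j) * (LINT u|uniform_sphere. h u * (u \<bullet> j)))"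
    by (subst Bochner_Integration.integral_sum)
      (auto intro!: integrable_uniform_sphere continuous_intros conth)
  finally have "(real DIM('a) - 1) * (LINT u|uniform_sphere. h u * (u \<bullet> w))
      = (\<Sum>j\<in>Basis. (w \<bullet> j) * ((real DIM('a) - 1) * (LINT u|uniform_sphere. h u * (u \<bullet> j))))"
    by (simp only: sum_distrib_left mult.left_commute)
  also have "\<dots> = (\<Sum>j\<in>Basis. (w \<bullet> j) * (LINT u|uniform_sphere. Dh u \<bullet> j - (Dh u \<bullet> u) * (u \<bullet> j)))"
    by (simp add: integral_uniform_sphere_by_parts_Basis[OF deriv cont])
  also have "\<dots> = (LINT u|uniform_sphere. (\<Sum>j\<in>Basis. (w \<bullet> j) * (Dh u \<bullet> j - (Dh u \<bullet> u) * (u \<bullet> j))))"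
    by (subst Bochner_Integration.integral_sum)
      (auto intro!: integrable_uniform_sphere continuous_intros cont)
  also have "\<dots> = (LINT u|uniform_sphere. Dh u \<bullet> w - (Dh u \<bullet> u) * (u \<bullet> w))"
    by (simp add: expand sum_distrib_left sum_subtractf algebra_simps)
  finally show ?thesis .
qed

text \<open>
  Integration by parts for the linear function \<open>u \<bullet> v\<close>, whose radial derivative reproduces the integrand.
\<close>
lemma integral_uniform_sphere_inner_inner:
  fixes v w :: "'a::euclidean_space"
  shows "real DIM('a) * (LINT u|uniform_sphere. (u \<bullet> v) * (u \<bullet> w)) = v \<bullet> w"
proof -
  have "(real DIM('a) - 1) * (LINT u|uniform_sphere. (u \<bullet> v) * (u \<bullet> w))
      = (LINT u|uniform_sphere. v \<bullet> w - (v \<bullet> u) * (u \<bullet> w))"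
    by (rule integral_uniform_sphere_by_parts)
      (auto simp: gderiv_def intro!: derivative_eq_intros)
  also have "\<dots> = v \<bullet> w - (LINT u|uniform_sphere. (u \<bullet> v) * (u \<bullet> w))"
    by (subst Bochner_Integration.integral_diff)
      (auto intro!: integrable_uniform_sphere continuous_intros simp: inner_commute)
  finally show ?thesis by (simp add: algebra_simps)
qed

text \<open>
  The estimate that replaces the divergence theorem on the ball. The trivial bound
  \<open>\<bar>h (\<alpha> u)\<bar> \<le> L \<alpha>\<^sup>2 / 2\<close> (for \<open>h 0 = 0\<close>) would only give the order \<open>L \<alpha>\<^sup>2 \<parallel>w\<parallel> / \<surd>d\<close>; the gain to \<open>1 / (d + 1)\<close> is what makes
  the bias of the gradient estimate independent of the dimension.
  With \<open>n = d - 1\<close>, integration by parts on the sphere of radius \<open>r\<close> is the equation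
  \<open>n A + r A' = r B\<close> for the mean \<open>A r\<close> of \<open>h (r u) * (u \<bullet> w)\<close> and the mean \<open>B r\<close> of
  \<open>\<nabla>h (r u) \<bullet> w\<close>. Hence \<open>(r\<^sup>n A)' = r\<^sup>n B \<le> L r\<^sup>n\<^sup>+\<^sup>1 \<parallel>w\<parallel>\<close>, and integrating from \<open>0\<close> to
  \<open>\<alpha>\<close> gives the claim.
\<close>
lemma integral_uniform_sphere_quadratic_bound:
  fixes h :: "'a::euclidean_space \<Rightarrow> real"
  assumes deriv: "\<And>x. GDERIV h x :> Dh x" and cont: "continuous_on UNIV Dh"
    and growth: "\<And>x. norm (Dh x) \<le> L * norm x" and \<alpha>: "\<alpha> > 0"
  shows "(LINT u|uniform_sphere. h (\<alpha> *\<^sub>R u) * (u \<bullet> w)) \<le> L * \<alpha>\<^sup>2 * norm w / (real DIM('a) + 1)"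
proof -
  have conth: "continuous_on UNIV h" by (rule GDERIV_continuous_on[OF deriv])
  define n where "n = DIM('a) - 1"
  have n: "real n = real DIM('a) - 1" unfolding n_def by (simp add: of_nat_diff Suc_leI)
  define A where "A = (\<lambda>r. LINT u|uniform_sphere. h (r *\<^sub>R u) * (u \<bullet> w))"
  define A' where "A' = (\<lambda>r. LINT u|uniform_sphere. (Dh (r *\<^sub>R u) \<bullet> u) * (u \<bullet> w))"
  define B where "B = (\<lambda>r. LINT u|uniform_sphere. Dh (r *\<^sub>R u) \<bullet> w)"
  have deriv_A: "(A has_real_derivative A' r) (at r)" for r
    unfolding A_def A'_def
  proof (rule DERIV_integral_uniform_sphere)
    show "((\<lambda>t. h (t *\<^sub>R u) * (u \<bullet> w)) has_real_derivative (Dh (t *\<^sub>R u) \<bullet> u) * (u \<bullet> w)) (at t)" for t u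
    proof -
      have "((\<lambda>t. h (t *\<^sub>R u)) has_real_derivative u \<bullet> Dh (t *\<^sub>R u)) (at t)"
        by (rule DERIV_GDERIV_compose[OF deriv]) (auto intro!: derivative_eq_intros)
      then show ?thesis by (auto intro!: derivative_eq_intros simp: inner_commute)
    qed
    show "continuous_on UNIV (\<lambda>u. h (t *\<^sub>R u) * (u \<bullet> w))" for t
      by (intro continuous_intros continuous_on_compose2[OF conth]) auto
    show "continuous_on UNIV (\<lambda>(t, u). (Dh (t *\<^sub>R u) \<bullet> u) * (u \<bullet> w))"
      unfolding case_prod_unfold by (intro continuous_intros continuous_on_compose2[OF cont]) auto
  qed
  have ode: "real n * A r + r * A' r = r * B r" for r
  proof -
    have "real n * A r = (LINT u|uniform_sphere. (r *\<^sub>R Dh (r *\<^sub>R u)) \<bullet> w - ((r *\<^sub>R Dh (r *\<^sub>R u)) \<bullet> u) * (u \<bullet> w))"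
      unfolding A_def n
    proof (rule integral_uniform_sphere_by_parts)
      show "GDERIV (\<lambda>x. h (r *\<^sub>R x)) x :> r *\<^sub>R Dh (r *\<^sub>R x)" for x
      proof -
        have "((\<lambda>x. r *\<^sub>R x) has_derivative (\<lambda>y. r *\<^sub>R y)) (at x)"
          by (auto intro!: derivative_eq_intros)
        from has_derivative_compose[OF this deriv[of "r *\<^sub>R x", unfolded gderiv_def]]
        show ?thesis by (simp add: gderiv_def)
      qed
      show "continuous_on UNIV (\<lambda>x. r *\<^sub>R Dh (r *\<^sub>R x))"
        by (intro continuous_intros continuous_on_compose2[OF cont]) auto
    qed
    also have "\<dots> = (LINT u|uniform_sphere. r * (Dh (r *\<^sub>R u) \<bullet> w) - r * ((Dh (r *\<^sub>R u) \<bullet> u) * (u \<bullet> w)))"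
      by (simp add: algebra_simps)
    also have "\<dots> = r * B r - r * A' r"
      unfolding B_def A'_def
      by (subst Bochner_Integration.integral_diff)
        (auto intro!: integrable_uniform_sphere continuous_intros continuous_on_compose2[OF cont])
    finally show ?thesis by simp
  qed
  have B_le: "B r \<le> L * r * norm w" if "r > 0" for r
  proof -
    have "B r \<le> (LINT u|(uniform_sphere :: 'a measure). L * r * norm w)"
      unfolding B_def
    proof (rule integral_uniform_sphere_mono)
      fix u :: 'a assume u: "norm u = 1"
      have "Dh (r *\<^sub>R u) \<bullet> w \<le> norm (Dh (r *\<^sub>R u)) * norm w" by (rule norm_cauchy_schwarz)
      also have "\<dots> \<le> (L * norm (r *\<^sub>R u)) * norm w" by (intro mult_right_mono growth) simp
      finally show "Dh (r *\<^sub>R u) \<bullet> w \<le> L * r * norm w" using u that by simp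
    qed (auto intro!: continuous_intros continuous_on_compose2[OF cont])
    then show ?thesis by simp
  qed
  \<comment> \<open>The difference of the two sides of the integrated inequality, which decreases from \<open>0\<close>.\<close>
  define \<psi> where "\<psi> = (\<lambda>r. r ^ n * A r - L * norm w / real (n + 2) * r ^ (n + 2))"
  have deriv_\<psi>: "(\<psi> has_real_derivative real n * r ^ (n - 1) * A r + r ^ n * A' r - L * norm w * r ^ (n + 1)) (at r)" for r
  proof -
    define c where "c = L * norm w / real (n + 2)"
    have c: "c * real (n + 2) = L * norm w" by (simp add: c_def)
    have "((\<lambda>r. r ^ n * A r - c * r ^ (n + 2)) has_real_derivative
        (real n * r ^ (n - Suc 0) * A r + A' r * r ^ n) - c * (real (n + 2) * r ^ (n + 2 - Suc 0))) (at r)"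
      by (intro DERIV_diff DERIV_mult DERIV_cmult DERIV_pow deriv_A)
    moreover have "c * (real (n + 2) * r ^ (n + 2 - Suc 0)) = L * norm w * r ^ (n + 1)"
      unfolding mult.assoc[symmetric] c by simp
    ultimately show ?thesis
      by (simp add: \<psi>_def c_def mult.commute[of "A' r"] mult.assoc)
  qed
  have "\<psi> \<alpha> \<le> \<psi> 0"
  proof (rule DERIV_nonpos_imp_decreasing_open[where f = \<psi> and a = 0 and b = \<alpha>])
    fix r :: real assume r: "0 < r" "r < \<alpha>"
    have pow: "real n * r ^ (n - 1) * r = real n * r ^ n" by (cases n) auto
    have "(real n * r ^ (n - 1) * A r + r ^ n * A' r - L * norm w * r ^ (n + 1)) * r
        = real n * r ^ (n - 1) * r * A r + r ^ n * r * A' r - L * norm w * r ^ (n + 1) * r"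
      by (simp only: distrib_right distrib_left left_diff_distrib right_diff_distrib ac_simps)
    also have "\<dots> = r ^ n * (real n * A r + r * A' r) - L * norm w * r ^ (n + 1) * r"
      unfolding pow by (simp only: distrib_left right_diff_distrib ac_simps)
    also have "\<dots> = r ^ (n + 1) * (B r - L * r * norm w)"
      unfolding ode by (simp add: algebra_simps)
    also have "\<dots> \<le> 0"
      using B_le[of r] r by (intro mult_nonneg_nonpos) auto
    finally have "real n * r ^ (n - 1) * A r + r ^ n * A' r - L * norm w * r ^ (n + 1) \<le> 0"
      using r by (simp add: mult_le_0_iff)
    with deriv_\<psi>[of r] show "\<exists>y. DERIV \<psi> r :> y \<and> y \<le> 0" by blast
  qed (use \<alpha> in \<open>auto intro!: continuous_at_imp_continuous_on DERIV_isCont deriv_\<psi>\<close>)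
  moreover have "A 0 = 0"
    by (simp add: A_def integral_uniform_sphere_inner)
  ultimately have "\<alpha> ^ n * A \<alpha> \<le> L * norm w / real (n + 2) * \<alpha> ^ (n + 2)"
    by (simp add: \<psi>_def)
  also have "\<dots> = \<alpha> ^ n * (L * \<alpha>\<^sup>2 * norm w / real (n + 2))"
    by (simp add: power_add power2_eq_square)
  finally have "A \<alpha> \<le> L * \<alpha>\<^sup>2 * norm w / real (n + 2)"
    by (rule mult_left_le_imp_le) (use \<alpha> in simp)
  then show ?thesis using n by (simp add: A_def add.commute)
qed

section \<open>Smooth functions near a point\<close>

lemma le_quadratic_of_gradient_growth:
  fixes h :: "'a::euclidean_space \<Rightarrow> real"
  assumes deriv: "\<And>x. GDERIV h x :> Dh x" and growth: "\<And>x. norm (Dh x) \<le> L * norm x"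
  shows "h v \<le> h 0 + L / 2 * (norm v)\<^sup>2"
proof -
  define \<phi> where "\<phi> = (\<lambda>t. h (t *\<^sub>R v) - L / 2 * (norm v)\<^sup>2 * t\<^sup>2)"
  have "\<phi> 1 \<le> \<phi> 0"
  proof (rule DERIV_nonpos_imp_nonincreasing[where f = \<phi> and a = 0 and b = 1])
    fix t :: real assume t: "0 \<le> t" "t \<le> 1"
    have "((\<lambda>t. h (t *\<^sub>R v)) has_real_derivative v \<bullet> Dh (t *\<^sub>R v)) (at t)"
      by (rule DERIV_GDERIV_compose[OF deriv]) (auto intro!: derivative_eq_intros)
    then have "(\<phi> has_real_derivative v \<bullet> Dh (t *\<^sub>R v) - L * (norm v)\<^sup>2 * t) (at t)"
      unfolding \<phi>_def by (auto intro!: derivative_eq_intros)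
    moreover have "v \<bullet> Dh (t *\<^sub>R v) \<le> norm v * (L * norm (t *\<^sub>R v))"
      by (rule order_trans[OF norm_cauchy_schwarz]) (intro mult_left_mono growth norm_ge_zero)
    then have "v \<bullet> Dh (t *\<^sub>R v) - L * (norm v)\<^sup>2 * t \<le> 0"
      using t by (simp add: power2_eq_square algebra_simps)
    ultimately show "\<exists>y. DERIV \<phi> t :> y \<and> y \<le> 0" by blast
  qed simp
  then show ?thesis by (simp add: \<phi>_def)
qed

text \<open>
  Its gradient is \<open>gradient f (x + v) - gradient f x\<close>, so for an \<open>L\<close>-smooth \<open>f\<close> it is a function of
  \<open>v\<close> to which \<open>le_quadratic_of_gradient_growth\<close> and \<open>integral_uniform_sphere_quadratic_bound\<close> apply.
\<close>
definition linear_remainder :: "('a::euclidean_space \<Rightarrow> real) \<Rightarrow> 'a \<Rightarrow> 'a \<Rightarrow> real" where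
  "linear_remainder f x v = f (x + v) - f x - v \<bullet> gradient f x"

context
  fixes f :: "'a::euclidean_space \<Rightarrow> real" and L :: real
  assumes smooth: "smooth_with L f"
begin

lemma GDERIV_smooth: "GDERIV f x :> gradient f x"
  using smooth by (simp add: GDERIV_gradient smooth_with_def)

lemma smooth_norm_gradient_diff: "norm (gradient f x - gradient f y) \<le> L * norm (x - y)"
  using smooth by (simp add: smooth_with_def)

lemma smooth_nonneg: "0 \<le> L"
proof -
  obtain b :: 'a where "b \<in> Basis" using nonempty_Basis by blast
  then show ?thesis
    using order_trans[OF norm_ge_zero smooth_norm_gradient_diff[of b 0]] by simp
qed

lemma smooth_continuous_on: "continuous_on S f"
  by (rule GDERIV_continuous_on[OF GDERIV_smooth])

lemma smooth_continuous_on_gradient: "continuous_on S (gradient f)"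
proof -
  have "L-lipschitz_on S (gradient f)"
    using smooth_norm_gradient_diff smooth_nonneg by (auto simp: lipschitz_on_def dist_norm)
  then show ?thesis by (rule lipschitz_on_continuous_on)
qed

lemma GDERIV_linear_remainder:
  "GDERIV (linear_remainder f x) v :> gradient f (x + v) - gradient f x"
proof -
  have "((\<lambda>v. x + v) has_derivative (\<lambda>y. y)) (at v)"
    by (auto intro!: derivative_eq_intros)
  from has_derivative_compose[OF this GDERIV_smooth[of "x + v", unfolded gderiv_def]]
  show ?thesis
    unfolding gderiv_def linear_remainder_def[abs_def]
    by (auto intro!: derivative_eq_intros simp: inner_diff_right)
qed

lemma norm_gradient_linear_remainder: "norm (gradient f (x + v) - gradient f x) \<le> L * norm v"
  using smooth_norm_gradient_diff[of "x + v" x] by simp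

lemma abs_linear_remainder_le: "\<bar>linear_remainder f x v\<bar> \<le> L / 2 * (norm v)\<^sup>2"
proof -
  have "linear_remainder f x 0 = 0" by (simp add: linear_remainder_def)
  moreover have "linear_remainder f x v \<le> linear_remainder f x 0 + L / 2 * (norm v)\<^sup>2"
    by (rule le_quadratic_of_gradient_growth[OF GDERIV_linear_remainder norm_gradient_linear_remainder])
  moreover have "- linear_remainder f x v \<le> - linear_remainder f x 0 + L / 2 * (norm v)\<^sup>2"
    by (rule le_quadratic_of_gradient_growth[OF GDERIV_minus[OF GDERIV_linear_remainder]])
      (simp only: norm_minus_cancel norm_gradient_linear_remainder)
  ultimately show ?thesis by simp
qed

lemma smooth_descent: "f (x + v) \<le> f x + v \<bullet> gradient f x + L / 2 * (norm v)\<^sup>2"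
  using abs_linear_remainder_le[of x v] unfolding linear_remainder_def by linarith

text \<open>
  Split \<open>f (x + \<alpha> u)\<close> into \<open>f x\<close>, the linear part and the remainder. The value \<open>f x\<close> and the residual from the
  previous point contribute nothing, as \<open>E[u] = 0\<close>; the linear part contributes exactly
  \<open>\<parallel>\<nabla>f x\<parallel>\<^sup>2\<close>; the remainder contributes at least \<open>- L \<alpha> \<parallel>\<nabla>f x\<parallel>\<close>, and this is absorbed by
  \<open>a b \<le> (a\<^sup>2 + b\<^sup>2) / 2\<close>.
\<close>
lemma residual_estimate_gradient_correlation:
  assumes \<alpha>: "\<alpha> > 0"
  shows "((norm (gradient f x))\<^sup>2 - L\<^sup>2 * \<alpha>\<^sup>2) / 2
    \<le> (LINT u|uniform_sphere. residual_estimate f \<alpha> x u x' u' \<bullet> gradient f x)"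
proof -
  let ?g = "gradient f x" and ?d = "real DIM('a)"
  define y where "y = f (x' + \<alpha> *\<^sub>R u')"
  define A where "A = (LINT u|uniform_sphere. linear_remainder f x (\<alpha> *\<^sub>R u) * (u \<bullet> ?g))"
  have cont_R: "continuous_on UNIV (linear_remainder f x)"
    by (rule GDERIV_continuous_on[OF GDERIV_linear_remainder])
  have split: "residual_estimate f \<alpha> x u x' u' \<bullet> ?g
      = ?d / \<alpha> * (linear_remainder f x (\<alpha> *\<^sub>R u) * (u \<bullet> ?g))
        + ?d / \<alpha> * (f x - y) * (u \<bullet> ?g) + ?d * ((u \<bullet> ?g) * (u \<bullet> ?g))" for u
    using \<alpha> by (simp add: residual_estimate_def linear_remainder_def y_def field_simps)
  have "(LINT u|uniform_sphere. residual_estimate f \<alpha> x u x' u' \<bullet> ?g)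
      = ?d / \<alpha> * A + ?d / \<alpha> * (f x - y) * (LINT u|uniform_sphere. u \<bullet> ?g)
        + ?d * (LINT u|uniform_sphere. (u \<bullet> ?g) * (u \<bullet> ?g))"
  proof -
    have "integrable uniform_sphere (\<lambda>u. linear_remainder f x (\<alpha> *\<^sub>R u) * (u \<bullet> ?g))"
      by (intro integrable_uniform_sphere continuous_intros continuous_on_compose2[OF cont_R]) auto
    moreover have "integrable uniform_sphere (\<lambda>u. u \<bullet> ?g)"
      "integrable uniform_sphere (\<lambda>u. (u \<bullet> ?g) * (u \<bullet> ?g))"
      by (intro integrable_uniform_sphere continuous_intros)+
    ultimately show ?thesis unfolding split A_def by simp
  qed
  also have "\<dots> = ?d / \<alpha> * A + (norm ?g)\<^sup>2"
    by (simp add: integral_uniform_sphere_inner integral_uniform_sphere_inner_inner power2_norm_eq_inner)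
  finally have eq: "(LINT u|uniform_sphere. residual_estimate f \<alpha> x u x' u' \<bullet> ?g) = ?d / \<alpha> * A + (norm ?g)\<^sup>2" .
  have "(LINT u|uniform_sphere. linear_remainder f x (\<alpha> *\<^sub>R u) * (u \<bullet> (- ?g)))
      \<le> L * \<alpha>\<^sup>2 * norm (- ?g) / (?d + 1)"
    by (rule integral_uniform_sphere_quadratic_bound[OF GDERIV_linear_remainder _ norm_gradient_linear_remainder \<alpha>])
      (intro continuous_intros continuous_on_compose2[OF smooth_continuous_on_gradient], auto)
  then have "- A \<le> L * \<alpha>\<^sup>2 * norm ?g / (?d + 1)"
    by (simp add: A_def)
  also have "\<dots> \<le> L * \<alpha>\<^sup>2 * norm ?g / ?d"
    using smooth_nonneg by (intro divide_left_mono) auto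
  finally have "?d / \<alpha> * (- A) \<le> ?d / \<alpha> * (L * \<alpha>\<^sup>2 * norm ?g / ?d)"
    using \<alpha> by (intro mult_left_mono) auto
  also have "\<dots> = L * \<alpha> * norm ?g"
    using \<alpha> by (simp add: power2_eq_square)
  finally have "- (L * \<alpha> * norm ?g) \<le> ?d / \<alpha> * A" by simp
  moreover have "0 \<le> (norm ?g - L * \<alpha>)\<^sup>2" by simp
  then have "L * \<alpha> * norm ?g \<le> ((norm ?g)\<^sup>2 + L\<^sup>2 * \<alpha>\<^sup>2) / 2"
    by (simp add: power2_diff power_mult_distrib mult_ac)
  ultimately show ?thesis unfolding eq by argo
qed

text \<open>
  The weight \<open>9 / 8\<close> on the linear part leaves the coefficient \<open>3 d\<close> in \<open>expectation_estimate_recursion\<close>,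
  which is small enough for \<open>sum_squared_gradients_bound\<close>.
\<close>
lemma integral_sphere_increment_squared:
  assumes \<alpha>: "\<alpha> > 0"
  shows "(LINT u|uniform_sphere. (f (x + \<alpha> *\<^sub>R u) - f x)\<^sup>2)
    \<le> 9 / 8 * \<alpha>\<^sup>2 / real DIM('a) * (norm (gradient f x))\<^sup>2 + 9 / 4 * L\<^sup>2 * \<alpha> ^ 4"
proof -
  let ?g = "gradient f x" and ?d = "real DIM('a)"
  have "(LINT u|uniform_sphere. (f (x + \<alpha> *\<^sub>R u) - f x)\<^sup>2)
      \<le> (LINT u|uniform_sphere. 9 / 8 * \<alpha>\<^sup>2 * ((u \<bullet> ?g) * (u \<bullet> ?g)) + 9 / 4 * L\<^sup>2 * \<alpha> ^ 4)"
  proof (rule integral_uniform_sphere_mono)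
    fix u :: 'a assume u: "norm u = 1"
    define a r where "a = \<alpha> * (u \<bullet> ?g)" and "r = linear_remainder f x (\<alpha> *\<^sub>R u)"
    have "\<bar>r\<bar> \<le> L / 2 * \<alpha>\<^sup>2"
      using abs_linear_remainder_le[of x "\<alpha> *\<^sub>R u"] u by (simp add: r_def power_mult_distrib)
    then have "r\<^sup>2 \<le> (L / 2 * \<alpha>\<^sup>2)\<^sup>2" by (metis abs_ge_zero power2_abs power_mono)
    then have r: "9 * r\<^sup>2 \<le> 9 / 4 * L\<^sup>2 * \<alpha> ^ 4" by (simp add: power_mult_distrib power_divide)
    have "f (x + \<alpha> *\<^sub>R u) - f x = a + r" by (simp add: a_def r_def linear_remainder_def)
    moreover have "0 \<le> (a - 8 * r)\<^sup>2" by simp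
    then have "(a + r)\<^sup>2 \<le> 9 / 8 * a\<^sup>2 + 9 * r\<^sup>2"
      by (simp add: power2_eq_square algebra_simps)
    ultimately have "(f (x + \<alpha> *\<^sub>R u) - f x)\<^sup>2 \<le> 9 / 8 * a\<^sup>2 + 9 / 4 * L\<^sup>2 * \<alpha> ^ 4"
      using r by simp
    then show "(f (x + \<alpha> *\<^sub>R u) - f x)\<^sup>2 \<le> 9 / 8 * \<alpha>\<^sup>2 * ((u \<bullet> ?g) * (u \<bullet> ?g)) + 9 / 4 * L\<^sup>2 * \<alpha> ^ 4"
      by (simp add: a_def power2_eq_square algebra_simps)
  qed (intro continuous_intros continuous_on_compose2[OF smooth_continuous_on[of UNIV]], auto)+
  also have "\<dots> = 9 / 8 * \<alpha>\<^sup>2 * (LINT u|uniform_sphere. (u \<bullet> ?g) * (u \<bullet> ?g)) + 9 / 4 * L\<^sup>2 * \<alpha> ^ 4"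
    by (subst Bochner_Integration.integral_add)
      (auto intro!: integrable_uniform_sphere continuous_intros)
  also have "(LINT u|uniform_sphere. (u \<bullet> ?g) * (u \<bullet> ?g)) = (norm ?g)\<^sup>2 / ?d"
    using integral_uniform_sphere_inner_inner[of ?g ?g] by (simp add: power2_norm_eq_inner field_simps)
  finally show ?thesis by simp
qed

text \<open>
  The derivative of \<open>f\<close> in the direction of its own gradient is \<open>\<parallel>\<nabla>f x\<parallel>\<^sup>2\<close>, and \<open>L0 * \<parallel>\<nabla>f x\<parallel>\<close> bounds every
  difference quotient in that direction.
\<close>
lemma smooth_lipschitz_norm_gradient:
  assumes "L0-lipschitz_on UNIV f"
  shows "norm (gradient f x) \<le> L0"
proof -
  let ?g = "gradient f x"
  have "((\<lambda>t. f (x + t *\<^sub>R ?g)) has_real_derivative ?g \<bullet> ?g) (at 0)"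
    by (rule DERIV_GDERIV_compose) (auto intro!: derivative_eq_intros GDERIV_smooth)
  then have "((\<lambda>t. (f (x + t *\<^sub>R ?g) - f x) / t) \<longlongrightarrow> ?g \<bullet> ?g) (at 0)"
    by (simp add: has_field_derivative_iff)
  moreover have "(f (x + t *\<^sub>R ?g) - f x) / t \<le> L0 * norm ?g" if "t \<noteq> 0" for t
  proof -
    have "\<bar>f (x + t *\<^sub>R ?g) - f x\<bar> \<le> L0 * (\<bar>t\<bar> * norm ?g)"
      using lipschitz_onD[OF assms, of "x + t *\<^sub>R ?g" x] by (simp add: dist_norm)
    then have "\<bar>(f (x + t *\<^sub>R ?g) - f x) / t\<bar> \<le> L0 * norm ?g"
      using that by (simp add: pos_divide_le_eq algebra_simps)
    then show ?thesis by linarith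
  qed
  then have "\<forall>\<^sub>F t in at 0. (f (x + t *\<^sub>R ?g) - f x) / t \<le> L0 * norm ?g"
    by (simp add: eventually_at_filter)
  ultimately have "?g \<bullet> ?g \<le> L0 * norm ?g"
    by (rule tendsto_upperbound) simp
  then have "norm ?g * norm ?g \<le> L0 * norm ?g"
    by (simp add: dot_square_norm power2_eq_square)
  then show ?thesis
    using lipschitz_on_nonneg[OF assms] by (cases "?g = 0") auto
qed

end

section \<open>Conditioning on an independent variable\<close>

text \<open>
  An inequality for the mean over \<open>U\<close> at every fixed value of \<open>X\<close> may be integrated over \<open>X\<close>. This is how
  statements about one step from a fixed point are transferred to the random iterates; independence
  enters as the factorisation of the joint distribution, which unlike \<open>indep_var\<close> allows the two
  variables to have values of different types.
\<close>
lemma (in prob_space) independent_expectation_mono: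
  fixes \<Phi> :: "'b \<times> 'c \<Rightarrow> real"
  assumes [measurable]: "random_variable N X" "random_variable K U"
    and joint: "distr M N X \<Otimes>\<^sub>M distr M K U = distr M (N \<Otimes>\<^sub>M K) (\<lambda>\<omega>. (X \<omega>, U \<omega>))"
    and [measurable]: "\<Phi> \<in> borel_measurable (N \<Otimes>\<^sub>M K)" "\<psi> \<in> borel_measurable N"
    and int_\<Phi>: "integrable M (\<lambda>\<omega>. \<Phi> (X \<omega>, U \<omega>))" and int_\<psi>: "integrable M (\<lambda>\<omega>. \<psi> (X \<omega>))"
    and le: "\<And>x. x \<in> space N \<Longrightarrow> (LINT v|distr M K U. \<Phi> (x, v)) \<le> \<psi> x"
  shows "expectation (\<lambda>\<omega>. \<Phi> (X \<omega>, U \<omega>)) \<le> expectation (\<lambda>\<omega>. \<psi> (X \<omega>))"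
proof -
  interpret X: prob_space "distr M N X" by (rule prob_space_distr) simp
  interpret U: prob_space "distr M K U" by (rule prob_space_distr) simp
  interpret XU: pair_prob_space "distr M N X" "distr M K U" ..
  have int: "integrable (distr M N X \<Otimes>\<^sub>M distr M K U) \<Phi>"
    unfolding joint by (subst integrable_distr_eq) (simp_all add: int_\<Phi>)
  have "expectation (\<lambda>\<omega>. \<Phi> (X \<omega>, U \<omega>)) = (LINT p|(distr M N X \<Otimes>\<^sub>M distr M K U). \<Phi> p)"
    unfolding joint by (subst integral_distr) simp_all
  also have "\<dots> = (LINT x|distr M N X. LINT v|distr M K U. \<Phi> (x, v))"
    by (rule XU.integral_fst'[OF int, symmetric])
  also have "\<dots> \<le> (LINT x|distr M N X. \<psi> x)"
    by (intro integral_mono XU.integrable_fst'[OF int])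
      (simp_all add: integrable_distr_eq int_\<psi> le)
  also have "\<dots> = expectation (\<lambda>\<omega>. \<psi> (X \<omega>))"
    by (subst integral_distr) simp_all
  finally show ?thesis .
qed

section \<open>The residual feedback iteration\<close>

lemma borel_measurable_residual_estimate [measurable (raw)]:
  fixes f :: "'a::euclidean_space \<Rightarrow> real"
  assumes "f \<in> borel_measurable borel" "x \<in> borel_measurable N" "v \<in> borel_measurable N"
    "x' \<in> borel_measurable N" "v' \<in> borel_measurable N"
  shows "(\<lambda>\<omega>. residual_estimate f \<alpha> (x \<omega>) (v \<omega>) (x' \<omega>) (v' \<omega>)) \<in> borel_measurable N"
proof -
  note [measurable] = assms
  show ?thesis unfolding residual_estimate_def by measurable
qed

text \<open>
  With truncated subtraction this also covers \<open>t = 0\<close>: there the two function values cancel, in accordance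
  with \<open>x\<^sub>0 = x\<^sub>1\<close>.
\<close>
lemma residual_iterate_Suc:
  "residual_iterate f \<alpha> \<eta> x1 u (Suc t) = residual_iterate f \<alpha> \<eta> x1 u t - \<eta> *\<^sub>R
     residual_estimate f \<alpha> (residual_iterate f \<alpha> \<eta> x1 u t) (u t)
       (residual_iterate f \<alpha> \<eta> x1 u (t - 1)) (u (t - 1))"
  by (cases t) (simp_all add: residual_estimate_def)

lemma residual_iterate_cong:
  assumes "\<And>s. s < t \<Longrightarrow> v s = v' s"
  shows "residual_iterate f \<alpha> \<eta> x1 v t = residual_iterate f \<alpha> \<eta> x1 v' t"
  using assms
proof (induction t rule: less_induct)
  case (less t)
  show ?case
  proof (cases t)
    case (Suc t')
    then show ?thesis
      using less.IH[of t'] less.IH[of "t' - 1"] less.prems by (simp add: residual_iterate_Suc)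
  qed simp
qed

lemma borel_measurable_residual_iterate:
  fixes f :: "'a::euclidean_space \<Rightarrow> real"
  assumes f: "f \<in> borel_measurable borel" and "\<And>s. s < t \<Longrightarrow> V s \<in> borel_measurable N"
  shows "(\<lambda>\<omega>. residual_iterate f \<alpha> \<eta> x1 (\<lambda>s. V s \<omega>) t) \<in> borel_measurable N"
  using assms(2)
proof (induction t rule: less_induct)
  case (less t)
  show ?case
  proof (cases t)
    case (Suc t')
    have [measurable]: "(\<lambda>\<omega>. residual_iterate f \<alpha> \<eta> x1 (\<lambda>s. V s \<omega>) t') \<in> borel_measurable N"
      "(\<lambda>\<omega>. residual_iterate f \<alpha> \<eta> x1 (\<lambda>s. V s \<omega>) (t' - 1)) \<in> borel_measurable N"
      "V t' \<in> borel_measurable N" "V (t' - 1) \<in> borel_measurable N" "f \<in> borel_measurable borel"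
      using Suc less f by auto
    show ?thesis unfolding Suc residual_iterate_Suc by measurable
  qed simp
qed

lemma norm_residual_estimate_le:
  fixes f :: "'a::euclidean_space \<Rightarrow> real"
  assumes lip: "L0-lipschitz_on UNIV f" and "\<alpha> > 0" "norm v = 1" "norm v' = 1"
  shows "norm (residual_estimate f \<alpha> x v x' v') \<le> real DIM('a) * (L0 * (norm x + norm x' + 2 * \<alpha>) / \<alpha>)"
proof -
  have "norm ((x + \<alpha> *\<^sub>R v) - (x' + \<alpha> *\<^sub>R v')) \<le> (norm x + \<alpha>) + (norm x' + \<alpha>)"
    using norm_triangle_ineq[of x "\<alpha> *\<^sub>R v"] norm_triangle_ineq[of x' "\<alpha> *\<^sub>R v'"] assms(2-)
    by (intro order_trans[OF norm_triangle_ineq4] add_mono) auto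
  then have "norm ((x + \<alpha> *\<^sub>R v) - (x' + \<alpha> *\<^sub>R v')) \<le> norm x + norm x' + 2 * \<alpha>" by simp
  from mult_left_mono[OF this lipschitz_on_nonneg[OF lip]]
  have "\<bar>f (x + \<alpha> *\<^sub>R v) - f (x' + \<alpha> *\<^sub>R v')\<bar> \<le> L0 * (norm x + norm x' + 2 * \<alpha>)"
    using lipschitz_onD[OF lip, of "x + \<alpha> *\<^sub>R v" "x' + \<alpha> *\<^sub>R v'"]
    unfolding dist_norm real_norm_def by (rule order_trans[rotated]) simp_all
  then show ?thesis
    using assms(2-) by (simp add: residual_estimate_def abs_mult divide_right_mono)
qed

locale residual_feedback = prob_space M for M :: "'w measure" +
  fixes f :: "'a::euclidean_space \<Rightarrow> real" and L0 L \<alpha> \<eta> :: real and x1 :: 'a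
    and u :: "nat \<Rightarrow> 'w \<Rightarrow> 'a" and T :: nat
  assumes lipschitz: "L0-lipschitz_on UNIV f" and smooth: "smooth_with L f" and \<alpha>_pos: "\<alpha> > 0"
    and indep: "indep_vars (\<lambda>_. borel) u {0..T}"
    and distr_u: "\<And>t. t \<le> T \<Longrightarrow> distr M borel (u t) = uniform_sphere"
begin

definition iterate :: "nat \<Rightarrow> 'w \<Rightarrow> 'a" where
  "iterate t \<omega> = residual_iterate f \<alpha> \<eta> x1 (\<lambda>s. u s \<omega>) t"

definition estimate :: "nat \<Rightarrow> 'w \<Rightarrow> 'a" where
  "estimate t \<omega> = residual_estimate f \<alpha> (iterate t \<omega>) (u t \<omega>) (iterate (t - 1) \<omega>) (u (t - 1) \<omega>)"

lemma iterate_0: "iterate 0 \<omega> = x1"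
  by (simp add: iterate_def)

lemma iterate_Suc: "iterate (Suc t) \<omega> = iterate t \<omega> - \<eta> *\<^sub>R estimate t \<omega>"
  by (simp only: iterate_def estimate_def residual_iterate_Suc)

lemma estimate_0: "estimate 0 \<omega> = 0"
  by (simp add: estimate_def residual_estimate_def)

lemma borel_measurable_f [measurable]: "f \<in> borel_measurable borel"
  by (intro borel_measurable_continuous_onI smooth_continuous_on[OF smooth])

lemma borel_measurable_gradient [measurable]: "gradient f \<in> borel_measurable borel"
  by (intro borel_measurable_continuous_onI smooth_continuous_on_gradient[OF smooth])

lemma borel_measurable_u: "t \<le> T \<Longrightarrow> random_variable borel (u t)"
  using indep unfolding indep_vars_def by auto

lemma borel_measurable_iterate: "t \<le> Suc T \<Longrightarrow> random_variable borel (iterate t)"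
  unfolding iterate_def[abs_def]
  by (intro borel_measurable_residual_iterate borel_measurable_f borel_measurable_u) auto

lemma borel_measurable_estimate: "t \<le> T \<Longrightarrow> random_variable borel (estimate t)"
  unfolding estimate_def[abs_def]
  by (intro borel_measurable_residual_estimate borel_measurable_f borel_measurable_iterate
      borel_measurable_u) auto

lemma AE_norm_u: "t \<le> T \<Longrightarrow> AE \<omega> in M. norm (u t \<omega>) = 1"
  using AE_distrD[OF borel_measurable_u, of t "\<lambda>v. norm v = 1"]
  by (simp only: distr_u AE_uniform_sphere)

lemma AE_norm_estimate_le:
  assumes "t \<le> T" "AE \<omega> in M. norm (iterate t \<omega>) \<le> K" "AE \<omega> in M. norm (iterate (t - 1) \<omega>) \<le> K'"
  shows "AE \<omega> in M. norm (estimate t \<omega>) \<le> real DIM('a) * (L0 * (K + K' + 2 * \<alpha>) / \<alpha>)"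
proof -
  have "t - 1 \<le> T" using assms(1) by simp
  from AE_norm_u[OF assms(1)] AE_norm_u[OF this] assms(2,3) show ?thesis
  proof eventually_elim
    case (elim \<omega>)
    have "real DIM('a) * (L0 * (norm (iterate t \<omega>) + norm (iterate (t - 1) \<omega>) + 2 * \<alpha>) / \<alpha>)
        \<le> real DIM('a) * (L0 * (K + K' + 2 * \<alpha>) / \<alpha>)"
      using elim \<alpha>_pos lipschitz_on_nonneg[OF lipschitz]
      by (intro mult_left_mono divide_right_mono) auto
    with norm_residual_estimate_le[OF lipschitz \<alpha>_pos elim(1,2)] show ?case
      unfolding estimate_def by (rule order_trans)
  qed
qed

text \<open>
  The steps are bounded because \<open>f\<close> is Lipschitz and the directions have norm one, so all the expectations
  below are those of almost surely bounded random variables.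
\<close>
lemma iterate_bounded: "t \<le> Suc T \<Longrightarrow> \<exists>K. AE \<omega> in M. norm (iterate t \<omega>) \<le> K"
proof (induction t rule: less_induct)
  case (less t)
  show ?case
  proof (cases t)
    case 0
    then show ?thesis by (auto simp: iterate_0 intro!: exI[of _ "norm x1"])
  next
    case (Suc t')
    have bounds: "t' < t" "t' \<le> Suc T" "t' - 1 < t" "t' - 1 \<le> Suc T"
      using less.prems Suc by auto
    obtain K where K: "AE \<omega> in M. norm (iterate t' \<omega>) \<le> K"
      using less.IH[OF bounds(1,2)] by blast
    obtain K' where K': "AE \<omega> in M. norm (iterate (t' - 1) \<omega>) \<le> K'"
      using less.IH[OF bounds(3,4)] by blast
    have "t' \<le> T" using less.prems Suc by simp
    from AE_norm_estimate_le[OF this K K'] K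
    have "AE \<omega> in M. norm (iterate t \<omega>) \<le> K + \<bar>\<eta>\<bar> * (real DIM('a) * (L0 * (K + K' + 2 * \<alpha>) / \<alpha>))"
    proof eventually_elim
      case (elim \<omega>)
      have "norm (\<eta> *\<^sub>R estimate t' \<omega>) \<le> \<bar>\<eta>\<bar> * (real DIM('a) * (L0 * (K + K' + 2 * \<alpha>) / \<alpha>))"
        unfolding norm_scaleR by (rule mult_left_mono[OF elim(1)]) simp
      with elim(2) show ?case unfolding Suc iterate_Suc
        by (intro order_trans[OF norm_triangle_ineq4] add_mono)
    qed
    then show ?thesis by blast
  qed
qed

lemma estimate_bounded:
  assumes t: "t \<le> T"
  shows "\<exists>K. AE \<omega> in M. norm (estimate t \<omega>) \<le> K"
proof -
  have bounds: "t \<le> Suc T" "t - 1 \<le> Suc T" using t by auto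
  obtain K where K: "AE \<omega> in M. norm (iterate t \<omega>) \<le> K"
    using iterate_bounded[OF bounds(1)] by blast
  obtain K' where K': "AE \<omega> in M. norm (iterate (t - 1) \<omega>) \<le> K'"
    using iterate_bounded[OF bounds(2)] by blast
  show ?thesis using AE_norm_estimate_le[OF t K K'] by blast
qed

lemma integrable_f_iterate:
  assumes "t \<le> Suc T"
  shows "integrable M (\<lambda>\<omega>. f (iterate t \<omega>))"
proof -
  note [measurable] = borel_measurable_iterate[OF assms]
  obtain K where "AE \<omega> in M. norm (iterate t \<omega>) \<le> K" using iterate_bounded[OF assms] by blast
  then have "AE \<omega> in M. norm (f (iterate t \<omega>)) \<le> \<bar>f 0\<bar> + L0 * K"
  proof eventually_elim
    case (elim \<omega>)
    have "\<bar>f (iterate t \<omega>) - f 0\<bar> \<le> L0 * norm (iterate t \<omega>)"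
      using lipschitz_onD[OF lipschitz, of "iterate t \<omega>" 0] by (simp add: dist_norm)
    moreover have "L0 * norm (iterate t \<omega>) \<le> L0 * K"
      by (intro mult_left_mono elim lipschitz_on_nonneg[OF lipschitz])
    ultimately show ?case by simp
  qed
  then show ?thesis by (rule integrable_const_bound) measurable
qed

lemma norm_gradient_le: "norm (gradient f x) \<le> L0"
  by (rule smooth_lipschitz_norm_gradient[OF smooth lipschitz])

lemma integrable_gradient:
  assumes "t \<le> Suc T"
  shows "integrable M (\<lambda>\<omega>. (norm (gradient f (iterate t \<omega>)))\<^sup>2)"
proof -
  note [measurable] = borel_measurable_iterate[OF assms]
  have "(norm (gradient f x))\<^sup>2 \<le> L0\<^sup>2" for x
    by (intro power_mono norm_gradient_le norm_ge_zero)
  then have "AE \<omega> in M. norm ((norm (gradient f (iterate t \<omega>)))\<^sup>2) \<le> L0\<^sup>2"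
    by simp
  then show ?thesis by (rule integrable_const_bound) measurable
qed

lemma integrable_estimate:
  assumes "t \<le> T"
  shows "integrable M (\<lambda>\<omega>. (norm (estimate t \<omega>))\<^sup>2)"
proof -
  note [measurable] = borel_measurable_estimate[OF assms]
  obtain K where "AE \<omega> in M. norm (estimate t \<omega>) \<le> K" using estimate_bounded[OF assms] by blast
  then have "AE \<omega> in M. norm ((norm (estimate t \<omega>))\<^sup>2) \<le> K\<^sup>2"
    by eventually_elim (simp add: power_mono)
  then show ?thesis by (rule integrable_const_bound) measurable
qed

lemma integrable_estimate_gradient:
  assumes "t \<le> T"
  shows "integrable M (\<lambda>\<omega>. estimate t \<omega> \<bullet> gradient f (iterate t \<omega>))"
proof -
  have [measurable]: "random_variable borel (estimate t)" "random_variable borel (iterate t)"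
    using borel_measurable_estimate[OF assms] borel_measurable_iterate[of t] assms by auto
  have bound: "\<bar>a \<bullet> b\<bar> \<le> (norm a)\<^sup>2 + (norm b)\<^sup>2" for a b :: 'a
  proof -
    have "2 * (norm a * norm b) \<le> (norm a)\<^sup>2 + (norm b)\<^sup>2"
      using sum_squares_bound[of "norm a" "norm b"] by (simp add: mult.assoc)
    moreover have "0 \<le> norm a * norm b" by simp
    ultimately show ?thesis using Cauchy_Schwarz_ineq2[of a b] by linarith
  qed
  have "integrable M (\<lambda>\<omega>. (norm (estimate t \<omega>))\<^sup>2 + (norm (gradient f (iterate t \<omega>)))\<^sup>2)"
    using assms by (intro Bochner_Integration.integrable_add integrable_estimate integrable_gradient) auto
  then show ?thesis
  proof (rule Bochner_Integration.integrable_bound)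
    show "AE \<omega> in M. norm (estimate t \<omega> \<bullet> gradient f (iterate t \<omega>))
        \<le> norm ((norm (estimate t \<omega>))\<^sup>2 + (norm (gradient f (iterate t \<omega>)))\<^sup>2)"
      using bound by (intro AE_I2) (simp only: real_norm_def abs_of_nonneg add_nonneg_nonneg zero_le_power2)
  qed measurable
qed

lemma integrable_increment:
  assumes "t \<le> T"
  shows "integrable M (\<lambda>\<omega>. (f (iterate t \<omega> + \<alpha> *\<^sub>R u t \<omega>) - f (iterate t \<omega>))\<^sup>2)"
proof -
  have [measurable]: "random_variable borel (u t)" "random_variable borel (iterate t)"
    using borel_measurable_u[OF assms] borel_measurable_iterate[of t] assms by auto
  have "AE \<omega> in M. norm ((f (iterate t \<omega> + \<alpha> *\<^sub>R u t \<omega>) - f (iterate t \<omega>))\<^sup>2) \<le> (L0 * \<alpha>)\<^sup>2"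
    using AE_norm_u[OF assms]
  proof eventually_elim
    case (elim \<omega>)
    then have "\<bar>f (iterate t \<omega> + \<alpha> *\<^sub>R u t \<omega>) - f (iterate t \<omega>)\<bar> \<le> L0 * \<alpha>"
      using lipschitz_onD[OF lipschitz, of "iterate t \<omega> + \<alpha> *\<^sub>R u t \<omega>" "iterate t \<omega>"] \<alpha>_pos
      by (simp add: dist_norm)
    from power_mono[OF this abs_ge_zero, of 2] show ?case by simp
  qed
  then show ?thesis by (rule integrable_const_bound) measurable
qed

section \<open>The mean of one step given the past\<close>

lemma borel_measurable_past:
  assumes "t \<le> T"
  shows "random_variable (\<Pi>\<^sub>M s\<in>{..<t}. borel) (\<lambda>\<omega>. \<lambda>s\<in>{..<t}. u s \<omega>)"
  using assms by (intro measurable_restrict borel_measurable_u) auto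

text \<open>
  Here the past of \<open>t\<close> is the restriction of the sequence of directions to \<open>{..<t}\<close>. The iterate
  at time \<open>t\<close> and the residual are functions of it.
\<close>
lemma joint_past:
  assumes t: "t \<le> T"
  shows "distr M (\<Pi>\<^sub>M s\<in>{..<t}. borel) (\<lambda>\<omega>. \<lambda>s\<in>{..<t}. u s \<omega>) \<Otimes>\<^sub>M distr M borel (u t)
    = distr M ((\<Pi>\<^sub>M s\<in>{..<t}. borel) \<Otimes>\<^sub>M borel) (\<lambda>\<omega>. (\<lambda>s\<in>{..<t}. u s \<omega>, u t \<omega>))"
proof -
  let ?N = "\<Pi>\<^sub>M s\<in>{..<t}. (borel :: 'a measure)" and ?past = "\<lambda>\<omega>. \<lambda>s\<in>{..<t}. u s \<omega>"
  let ?K = "\<Pi>\<^sub>M s\<in>{t}. (borel :: 'a measure)" and ?now = "\<lambda>\<omega>. \<lambda>s\<in>{t}. u s \<omega>"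
  have past [measurable]: "random_variable ?N ?past" by (rule borel_measurable_past[OF t])
  have u [measurable]: "random_variable borel (u t)" by (rule borel_measurable_u[OF t])
  have [measurable]: "random_variable ?K ?now"
    using t by (intro measurable_restrict borel_measurable_u) auto
  have comp [measurable]: "(\<lambda>q. q t) \<in> measurable ?K borel"
    by (rule measurable_component_singleton) simp
  have "indep_var ?N ?past ?K ?now"
    using t by (intro indep_var_restrict[OF indep]) auto
  then have joint: "distr M ?N ?past \<Otimes>\<^sub>M distr M ?K ?now = distr M (?N \<Otimes>\<^sub>M ?K) (\<lambda>\<omega>. (?past \<omega>, ?now \<omega>))"
    unfolding indep_var_distribution_eq by simp
  have u_eq: "distr M borel (u t) = distr (distr M ?K ?now) borel (\<lambda>q. q t)"
    by (subst distr_distr) (simp_all add: o_def)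
  have sf: "sigma_finite_measure (distr (distr M ?K ?now) borel (\<lambda>q. q t))"
    unfolding u_eq[symmetric] by (intro prob_space_imp_sigma_finite prob_space_distr u)
  have "distr M ?N ?past \<Otimes>\<^sub>M distr M borel (u t)
      = distr (distr M ?N ?past) ?N (\<lambda>p. p) \<Otimes>\<^sub>M distr (distr M ?K ?now) borel (\<lambda>q. q t)"
    unfolding u_eq by (simp add: distr_distr o_def)
  also have "\<dots> = distr (distr M ?N ?past \<Otimes>\<^sub>M distr M ?K ?now) (?N \<Otimes>\<^sub>M borel) (\<lambda>(p, q). (p, q t))"
    by (rule pair_measure_distr[OF _ _ sf]) simp_all
  also have "\<dots> = distr M (?N \<Otimes>\<^sub>M borel) (\<lambda>\<omega>. (?past \<omega>, u t \<omega>))"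
    unfolding joint by (subst distr_distr) (simp_all add: o_def)
  finally show ?thesis .
qed

lemma iterate_past:
  "s \<le> t \<Longrightarrow> residual_iterate f \<alpha> \<eta> x1 (\<lambda>s\<in>{..<t}. u s \<omega>) s = iterate s \<omega>"
  unfolding iterate_def by (rule residual_iterate_cong) simp

lemma borel_measurable_iterate_past:
  "s \<le> t \<Longrightarrow> (\<lambda>p. residual_iterate f \<alpha> \<eta> x1 p s) \<in> borel_measurable (\<Pi>\<^sub>M s\<in>{..<t}. borel)"
  by (intro borel_measurable_residual_iterate borel_measurable_f measurable_component_singleton) auto

lemma expectation_increment_le:
  assumes t: "t \<le> T"
  shows "expectation (\<lambda>\<omega>. (f (iterate t \<omega> + \<alpha> *\<^sub>R u t \<omega>) - f (iterate t \<omega>))\<^sup>2)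
    \<le> 9 / 8 * \<alpha>\<^sup>2 / real DIM('a) * expectation (\<lambda>\<omega>. (norm (gradient f (iterate t \<omega>)))\<^sup>2)
      + 9 / 4 * L\<^sup>2 * \<alpha> ^ 4"
proof -
  let ?N = "\<Pi>\<^sub>M s\<in>{..<t}. (borel :: 'a measure)" and ?past = "\<lambda>\<omega>. \<lambda>s\<in>{..<t}. u s \<omega>"
  define x where "x = (\<lambda>p. residual_iterate f \<alpha> \<eta> x1 p t)"
  have [measurable]: "x \<in> borel_measurable ?N"
    unfolding x_def by (rule borel_measurable_iterate_past) simp
  have x: "x (?past \<omega>) = iterate t \<omega>" for \<omega> by (simp add: x_def iterate_past)
  define \<Phi> where "\<Phi> = (\<lambda>(p, v). (f (x p + \<alpha> *\<^sub>R v) - f (x p))\<^sup>2)"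
  define \<psi> where "\<psi> = (\<lambda>p. 9 / 8 * \<alpha>\<^sup>2 / real DIM('a) * (norm (gradient f (x p)))\<^sup>2 + 9 / 4 * L\<^sup>2 * \<alpha> ^ 4)"
  have "expectation (\<lambda>\<omega>. \<Phi> (?past \<omega>, u t \<omega>)) \<le> expectation (\<lambda>\<omega>. \<psi> (?past \<omega>))"
  proof (rule independent_expectation_mono[OF borel_measurable_past[OF t] borel_measurable_u[OF t] joint_past[OF t]])
    show "\<Phi> \<in> borel_measurable (?N \<Otimes>\<^sub>M borel)" unfolding \<Phi>_def case_prod_unfold by measurable
    show "\<psi> \<in> borel_measurable ?N" unfolding \<psi>_def by measurable
    show "integrable M (\<lambda>\<omega>. \<Phi> (?past \<omega>, u t \<omega>))"
      using integrable_increment[OF t] by (simp add: \<Phi>_def x)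
    show "integrable M (\<lambda>\<omega>. \<psi> (?past \<omega>))"
      using integrable_gradient[of t] t by (simp add: \<psi>_def x)
    show "(LINT v|distr M borel (u t). \<Phi> (p, v)) \<le> \<psi> p" for p
      using integral_sphere_increment_squared[OF smooth \<alpha>_pos, of "x p"]
      by (simp add: \<Phi>_def \<psi>_def distr_u[OF t])
  qed
  also have "\<dots> = 9 / 8 * \<alpha>\<^sup>2 / real DIM('a) * expectation (\<lambda>\<omega>. (norm (gradient f (iterate t \<omega>)))\<^sup>2)
      + 9 / 4 * L\<^sup>2 * \<alpha> ^ 4"
    using integrable_gradient[of t] t by (simp add: \<psi>_def x prob_space)
  finally show ?thesis by (simp add: \<Phi>_def x)
qed

lemma expectation_estimate_gradient_ge:
  assumes t: "1 \<le> t" "t \<le> T"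
  shows "(expectation (\<lambda>\<omega>. (norm (gradient f (iterate t \<omega>)))\<^sup>2) - L\<^sup>2 * \<alpha>\<^sup>2) / 2
    \<le> expectation (\<lambda>\<omega>. estimate t \<omega> \<bullet> gradient f (iterate t \<omega>))"
proof -
  let ?N = "\<Pi>\<^sub>M s\<in>{..<t}. (borel :: 'a measure)" and ?past = "\<lambda>\<omega>. \<lambda>s\<in>{..<t}. u s \<omega>"
  define x where "x = (\<lambda>s p. residual_iterate f \<alpha> \<eta> x1 p s)"
  have [measurable]: "x t \<in> borel_measurable ?N" "x (t - 1) \<in> borel_measurable ?N"
    unfolding x_def by (rule borel_measurable_iterate_past; simp)+
  have [measurable]: "(\<lambda>p. p (t - 1)) \<in> borel_measurable ?N"
    using t by (intro measurable_component_singleton) auto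
  have x: "x t (?past \<omega>) = iterate t \<omega>" "x (t - 1) (?past \<omega>) = iterate (t - 1) \<omega>" for \<omega>
    by (simp_all add: x_def iterate_past)
  define \<Phi> where "\<Phi> = (\<lambda>(p, v).
    - (residual_estimate f \<alpha> (x t p) v (x (t - 1) p) (p (t - 1)) \<bullet> gradient f (x t p)))"
  define \<psi> where "\<psi> = (\<lambda>p. - (((norm (gradient f (x t p)))\<^sup>2 - L\<^sup>2 * \<alpha>\<^sup>2) / 2))"
  have \<Phi>: "\<Phi> (?past \<omega>, u t \<omega>) = - (estimate t \<omega> \<bullet> gradient f (iterate t \<omega>))" for \<omega>
    using t by (simp add: \<Phi>_def x[unfolded One_nat_def] estimate_def)
  have "expectation (\<lambda>\<omega>. \<Phi> (?past \<omega>, u t \<omega>)) \<le> expectation (\<lambda>\<omega>. \<psi> (?past \<omega>))"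
  proof (rule independent_expectation_mono[OF borel_measurable_past[OF t(2)] borel_measurable_u[OF t(2)] joint_past[OF t(2)]])
    show "\<Phi> \<in> borel_measurable (?N \<Otimes>\<^sub>M borel)" unfolding \<Phi>_def case_prod_unfold by measurable
    show "\<psi> \<in> borel_measurable ?N" unfolding \<psi>_def by measurable
    show "integrable M (\<lambda>\<omega>. \<Phi> (?past \<omega>, u t \<omega>))"
      using integrable_estimate_gradient[OF t(2)] by (simp add: \<Phi>)
    show "integrable M (\<lambda>\<omega>. \<psi> (?past \<omega>))"
      using integrable_gradient[of t] t by (simp add: \<psi>_def x)
    show "(LINT v|distr M borel (u t). \<Phi> (p, v)) \<le> \<psi> p" for p
      using residual_estimate_gradient_correlation[OF smooth \<alpha>_pos, of "x t p" "x (t - 1) p" "p (t - 1)"]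
      by (simp add: \<Phi>_def \<psi>_def distr_u[OF t(2)])
  qed
  also have "\<dots> = - ((expectation (\<lambda>\<omega>. (norm (gradient f (iterate t \<omega>)))\<^sup>2) - L\<^sup>2 * \<alpha>\<^sup>2) / 2)"
    using integrable_gradient[of t] t by (simp add: \<psi>_def x prob_space)
  finally show ?thesis by (simp add: \<Phi>)
qed

lemma expectation_descent:
  assumes t: "1 \<le> t" "t \<le> T" and \<eta>: "0 \<le> \<eta>"
  shows "expectation (\<lambda>\<omega>. f (iterate (Suc t) \<omega>)) \<le> expectation (\<lambda>\<omega>. f (iterate t \<omega>))
    - \<eta> / 2 * (expectation (\<lambda>\<omega>. (norm (gradient f (iterate t \<omega>)))\<^sup>2) - L\<^sup>2 * \<alpha>\<^sup>2)
    + L * \<eta>\<^sup>2 / 2 * expectation (\<lambda>\<omega>. (norm (estimate t \<omega>))\<^sup>2)"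
proof -
  let ?c = "\<lambda>\<omega>. estimate t \<omega> \<bullet> gradient f (iterate t \<omega>)"
  note int = integrable_f_iterate[of t] integrable_f_iterate[of "Suc t"]
    integrable_estimate_gradient[of t] integrable_estimate[of t]
  have "expectation (\<lambda>\<omega>. f (iterate (Suc t) \<omega>))
      \<le> expectation (\<lambda>\<omega>. f (iterate t \<omega>) - \<eta> * ?c \<omega> + L * \<eta>\<^sup>2 / 2 * (norm (estimate t \<omega>))\<^sup>2)"
  proof (rule integral_mono)
    fix \<omega>
    show "f (iterate (Suc t) \<omega>) \<le> f (iterate t \<omega>) - \<eta> * ?c \<omega> + L * \<eta>\<^sup>2 / 2 * (norm (estimate t \<omega>))\<^sup>2"
      using smooth_descent[OF smooth, of "iterate t \<omega>" "- \<eta> *\<^sub>R estimate t \<omega>"]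
      by (simp add: iterate_Suc power_mult_distrib)
  qed (use int t in auto)
  also have "\<dots> = expectation (\<lambda>\<omega>. f (iterate t \<omega>)) - \<eta> * expectation ?c
      + L * \<eta>\<^sup>2 / 2 * expectation (\<lambda>\<omega>. (norm (estimate t \<omega>))\<^sup>2)"
    using int t by simp
  finally show ?thesis
    using mult_left_mono[OF expectation_estimate_gradient_ge[OF t] \<eta>] by (simp add: algebra_simps)
qed

text \<open>
  The difference \<open>f (x\<^sub>t\<^sub>+\<^sub>1 + \<alpha> u\<^sub>t\<^sub>+\<^sub>1) - f (x\<^sub>t + \<alpha> u\<^sub>t)\<close> is split at \<open>f x\<^sub>t\<^sub>+\<^sub>1\<close> and \<open>f x\<^sub>t\<close>. In this way each
  direction is paired with the iterate of its own time, of which it is independent; \<open>u\<^sub>t\<close> and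
  \<open>x\<^sub>t\<^sub>+\<^sub>1\<close> are dependent.
\<close>
lemma expectation_estimate_recursion:
  assumes t: "Suc t \<le> T" and \<eta>: "16 * (real DIM('a))\<^sup>2 * L0\<^sup>2 * \<eta>\<^sup>2 \<le> \<alpha>\<^sup>2"
  shows "expectation (\<lambda>\<omega>. (norm (estimate (Suc t) \<omega>))\<^sup>2)
    \<le> expectation (\<lambda>\<omega>. (norm (estimate t \<omega>))\<^sup>2) / 4
      + 3 * real DIM('a) * (expectation (\<lambda>\<omega>. (norm (gradient f (iterate (Suc t) \<omega>)))\<^sup>2)
          + expectation (\<lambda>\<omega>. (norm (gradient f (iterate t \<omega>)))\<^sup>2))
      + 12 * (real DIM('a))\<^sup>2 * L\<^sup>2 * \<alpha>\<^sup>2"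
proof -
  let ?d = "real DIM('a)"
  define a where "a = (\<lambda>t \<omega>. (f (iterate t \<omega> + \<alpha> *\<^sub>R u t \<omega>) - f (iterate t \<omega>))\<^sup>2)"
  define D where "D = (\<lambda>t. expectation (\<lambda>\<omega>. (norm (gradient f (iterate t \<omega>)))\<^sup>2))"
  define G where "G = (\<lambda>t. expectation (\<lambda>\<omega>. (norm (estimate t \<omega>))\<^sup>2))"
  have pointwise: "(norm (estimate (Suc t) \<omega>))\<^sup>2
      \<le> (norm (estimate t \<omega>))\<^sup>2 / 4 + 8 / 3 * ?d\<^sup>2 / \<alpha>\<^sup>2 * (a (Suc t) \<omega> + a t \<omega>)"
    if u1: "norm (u (Suc t) \<omega>) = 1" for \<omega>
  proof -
    \<comment> \<open>The weights in \<open>(A + B - C)\<^sup>2 \<le> 4 / 3 * (A - C)\<^sup>2 + 4 * B\<^sup>2\<close> are chosen such that the step size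
      condition turns the last term into a quarter of the previous squared norm.\<close>
    define A where "A = f (iterate (Suc t) \<omega> + \<alpha> *\<^sub>R u (Suc t) \<omega>) - f (iterate (Suc t) \<omega>)"
    define B where "B = f (iterate (Suc t) \<omega>) - f (iterate t \<omega>)"
    define C where "C = f (iterate t \<omega> + \<alpha> *\<^sub>R u t \<omega>) - f (iterate t \<omega>)"
    have "estimate (Suc t) \<omega> = (?d * ((A + B - C) / \<alpha>)) *\<^sub>R u (Suc t) \<omega>"
      by (simp add: estimate_def residual_estimate_def A_def B_def C_def)
    then have norm: "(norm (estimate (Suc t) \<omega>))\<^sup>2 = ?d\<^sup>2 / \<alpha>\<^sup>2 * (A + B - C)\<^sup>2"
      using u1 by (simp add: power_mult_distrib power_divide)
    have "3 * (A + B - C)\<^sup>2 + (A - C - 3 * B)\<^sup>2 + 4 * (A + C)\<^sup>2 = 8 * (A\<^sup>2 + C\<^sup>2) + 12 * B\<^sup>2"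
      by algebra
    moreover have "0 \<le> (A - C - 3 * B)\<^sup>2" "0 \<le> (A + C)\<^sup>2" by simp_all
    ultimately have "(A + B - C)\<^sup>2 \<le> 8 / 3 * (A\<^sup>2 + C\<^sup>2) + 4 * B\<^sup>2"
      by linarith
    then have "(norm (estimate (Suc t) \<omega>))\<^sup>2 \<le> ?d\<^sup>2 / \<alpha>\<^sup>2 * (8 / 3 * (A\<^sup>2 + C\<^sup>2) + 4 * B\<^sup>2)"
      unfolding norm by (intro mult_left_mono) auto
    moreover have "?d\<^sup>2 / \<alpha>\<^sup>2 * (4 * B\<^sup>2) \<le> (norm (estimate t \<omega>))\<^sup>2 / 4"
    proof -
      have "\<bar>B\<bar> \<le> L0 * (\<bar>\<eta>\<bar> * norm (estimate t \<omega>))"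
        using lipschitz_onD[OF lipschitz, of "iterate (Suc t) \<omega>" "iterate t \<omega>"]
        by (simp add: B_def dist_norm iterate_Suc)
      from power_mono[OF this abs_ge_zero, of 2]
      have "B\<^sup>2 \<le> L0\<^sup>2 * \<eta>\<^sup>2 * (norm (estimate t \<omega>))\<^sup>2"
        by (simp add: power_mult_distrib mult.assoc)
      then have "16 * ?d\<^sup>2 * B\<^sup>2 \<le> 16 * ?d\<^sup>2 * (L0\<^sup>2 * \<eta>\<^sup>2 * (norm (estimate t \<omega>))\<^sup>2)"
        by (intro mult_left_mono) auto
      also have "\<dots> \<le> \<alpha>\<^sup>2 * (norm (estimate t \<omega>))\<^sup>2"
        using mult_right_mono[OF \<eta>, of "(norm (estimate t \<omega>))\<^sup>2"] by (simp add: mult.assoc)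
      finally show ?thesis using \<alpha>_pos by (simp add: field_simps)
    qed
    ultimately show ?thesis by (simp add: a_def A_def C_def algebra_simps add_divide_distrib)
  qed
  have int: "integrable M (a (Suc t))" "integrable M (a t)"
    "integrable M (\<lambda>\<omega>. (norm (estimate t \<omega>))\<^sup>2)" "integrable M (\<lambda>\<omega>. (norm (estimate (Suc t) \<omega>))\<^sup>2)"
    using integrable_increment[of t] integrable_increment[of "Suc t"] integrable_estimate[of t]
      integrable_estimate[of "Suc t"] t by (auto simp: a_def)
  have "G (Suc t) \<le> expectation (\<lambda>\<omega>. (norm (estimate t \<omega>))\<^sup>2 / 4 + 8 / 3 * ?d\<^sup>2 / \<alpha>\<^sup>2 * (a (Suc t) \<omega> + a t \<omega>))"
    unfolding G_def
    by (rule integral_mono_AE) (use int AE_norm_u[OF t] pointwise in auto)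
  also have "\<dots> = G t / 4 + 8 / 3 * ?d\<^sup>2 / \<alpha>\<^sup>2 * (expectation (a (Suc t)) + expectation (a t))"
    using int by (simp add: G_def)
  also have "\<dots> \<le> G t / 4 + 8 / 3 * ?d\<^sup>2 / \<alpha>\<^sup>2 * ((9 / 8 * \<alpha>\<^sup>2 / ?d * D (Suc t) + 9 / 4 * L\<^sup>2 * \<alpha> ^ 4)
      + (9 / 8 * \<alpha>\<^sup>2 / ?d * D t + 9 / 4 * L\<^sup>2 * \<alpha> ^ 4))"
    using t unfolding D_def a_def
    by (intro add_left_mono mult_left_mono add_mono expectation_increment_le) auto
  also have "\<dots> = G t / 4 + 3 * ?d * (D (Suc t) + D t) + 12 * ?d\<^sup>2 * L\<^sup>2 * \<alpha>\<^sup>2"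
    using \<alpha>_pos by (simp add: field_simps power2_eq_square power4_eq_xxxx)
  finally show ?thesis by (simp add: G_def D_def)
qed

end

section \<open>Summing the two recursions\<close>

text \<open>
  Summing the recursion bounds \<open>3 / 4\<close> of the sum of the \<open>G t\<close> by \<open>6 * d\<close> times the sum of the \<open>D t\<close>
  and lower order terms. Inserted into the telescoped descent inequality, this uses up at most half of
  the gain \<open>\<eta> / 2\<close> per unit of \<open>D t\<close>.
\<close>
lemma sum_squared_gradients_bound:
  fixes F D G :: "nat \<Rightarrow> real"
  assumes pos: "0 < \<eta>" "0 \<le> L" "0 \<le> d" and \<eta>: "16 * d * L * \<eta> \<le> 1"
    and descent: "\<And>t. 1 \<le> t \<Longrightarrow> t \<le> T \<Longrightarrow> F (Suc t) \<le> F t - \<eta> / 2 * (D t - b) + L * \<eta>\<^sup>2 / 2 * G t"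
    and recursion: "\<And>t. Suc t \<le> T \<Longrightarrow> G (Suc t) \<le> G t / 4 + 3 * d * (D (Suc t) + D t) + c"
    and nonneg: "\<And>t. 0 \<le> D t" "\<And>t. 0 \<le> G t" and G0: "G 0 = 0"
  shows "(\<Sum>t=1..T. D t) \<le> 4 * (F 1 - F (Suc T)) / \<eta> + 2 * b * T + 8 * d * L * \<eta> * D 0 + 8 / 3 * L * \<eta> * c * T"
proof -
  define SD where "SD = (\<lambda>n. \<Sum>t=1..n. D t)"
  define SG where "SG = (\<lambda>n. \<Sum>t=1..n. G t)"
  have SD_nonneg: "0 \<le> SD n" for n unfolding SD_def by (intro sum_nonneg nonneg)
  have "F (Suc n) \<le> F 1 - \<eta> / 2 * (SD n - b * n) + L * \<eta>\<^sup>2 / 2 * SG n" if "n \<le> T" for n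
    using that
  proof (induction n)
    case (Suc n)
    then have "F (Suc n) \<le> F 1 - \<eta> / 2 * (SD n - b * n) + L * \<eta>\<^sup>2 / 2 * SG n" by simp
    moreover have "F (Suc (Suc n)) \<le> F (Suc n) - \<eta> / 2 * (D (Suc n) - b) + L * \<eta>\<^sup>2 / 2 * G (Suc n)"
      using Suc.prems by (intro descent) auto
    ultimately show ?case
      by (simp add: SD_def SG_def algebra_simps add_divide_distrib diff_divide_distrib)
  qed (simp add: SD_def SG_def)
  then have total: "F (Suc T) \<le> F 1 - \<eta> / 2 * (SD T - b * T) + L * \<eta>\<^sup>2 / 2 * SG T" by simp
  \<comment> \<open>The terms \<open>G n\<close> and \<open>D n\<close> that the shifted sums on the right do not contain are kept, to make the
    induction work.\<close>
  have "SG n \<le> (SG n - G n) / 4 + 3 * d * (2 * SD n + D 0 - D n) + c * n" if "n \<le> T" for n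
    using that
  proof (induction n)
    case (Suc n)
    then have "SG n \<le> (SG n - G n) / 4 + 3 * d * (2 * SD n + D 0 - D n) + c * n" by simp
    moreover have "G (Suc n) \<le> G n / 4 + 3 * d * (D (Suc n) + D n) + c"
      using Suc.prems by (rule recursion)
    ultimately show ?case
      by (simp add: SD_def SG_def algebra_simps add_divide_distrib diff_divide_distrib)
  qed (simp add: SD_def SG_def G0)
  from this[of T] have "SG T \<le> (SG T - G T) / 4 + 3 * d * (2 * SD T + D 0 - D T) + c * T" by simp
  moreover have "3 * d * (2 * SD T + D 0 - D T) = 6 * (d * SD T) + 3 * (d * D 0) - 3 * (d * D T)"
    by (simp add: algebra_simps)
  moreover have "0 \<le> d * D T" using pos nonneg by simp
  ultimately have SG: "SG T \<le> 8 * (d * SD T) + 4 * (d * D 0) + 4 / 3 * (c * T)"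
    using nonneg(2)[of T] by argo
  have "L * \<eta>\<^sup>2 / 2 * SG T \<le> L * \<eta>\<^sup>2 / 2 * (8 * (d * SD T) + 4 * (d * D 0) + 4 / 3 * (c * T))"
    using SG pos by (intro mult_left_mono) auto
  also have "\<dots> = \<eta> / 4 * (16 * d * L * \<eta> * SD T) + \<eta> / 4 * (8 * d * L * \<eta> * D 0 + 8 / 3 * L * \<eta> * c * T)"
    by (simp add: power2_eq_square algebra_simps)
  also have "\<dots> \<le> \<eta> / 4 * SD T + \<eta> / 4 * (8 * d * L * \<eta> * D 0 + 8 / 3 * L * \<eta> * c * T)"
    using mult_right_mono[OF \<eta> SD_nonneg[of T]] pos by (intro add_right_mono mult_left_mono) auto
  finally have "\<eta> / 4 * SD T \<le> F 1 - F (Suc T)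
      + \<eta> / 4 * (2 * b * T + 8 * d * L * \<eta> * D 0 + 8 / 3 * L * \<eta> * c * T)"
    using total by (simp add: algebra_simps)
  then have "SD T \<le> (F 1 - F (Suc T)
      + \<eta> / 4 * (2 * b * T + 8 * d * L * \<eta> * D 0 + 8 / 3 * L * \<eta> * c * T)) / (\<eta> / 4)"
    using pos by (subst pos_le_divide_eq) (simp_all add: mult.commute)
  also have "\<dots> = 4 * (F 1 - F (Suc T)) / \<eta> + (2 * b * T + 8 * d * L * \<eta> * D 0 + 8 / 3 * L * \<eta> * c * T)"
    using pos by (simp add: add_divide_distrib)
  finally show ?thesis by (simp add: SD_def)
qed

lemma (in residual_feedback) sum_expected_squared_gradients:
  assumes \<eta>: "0 < \<eta>" "16 * real DIM('a) * L * \<eta> \<le> 1" "16 * (real DIM('a))\<^sup>2 * L0\<^sup>2 * \<eta>\<^sup>2 \<le> \<alpha>\<^sup>2"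
    and min: "\<And>y. m \<le> f y"
  shows "(\<Sum>t=1..T. expectation (\<lambda>\<omega>. (norm (gradient f (iterate t \<omega>)))\<^sup>2))
    \<le> 4 * (f x1 - m) / \<eta> + 2 * L\<^sup>2 * \<alpha>\<^sup>2 * T + 8 * real DIM('a) * L * \<eta> * L0\<^sup>2
      + 32 * \<eta> * (real DIM('a))\<^sup>2 * L ^ 3 * \<alpha>\<^sup>2 * T"
proof -
  let ?d = "real DIM('a)"
  define F where "F = (\<lambda>t. expectation (\<lambda>\<omega>. f (iterate t \<omega>)))"
  define D where "D = (\<lambda>t. expectation (\<lambda>\<omega>. (norm (gradient f (iterate t \<omega>)))\<^sup>2))"
  define G where "G = (\<lambda>t. expectation (\<lambda>\<omega>. (norm (estimate t \<omega>))\<^sup>2))"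
  have L: "0 \<le> L" by (rule smooth_nonneg[OF smooth])
  have sum: "(\<Sum>t=1..T. D t) \<le> 4 * (F 1 - F (Suc T)) / \<eta> + 2 * (L\<^sup>2 * \<alpha>\<^sup>2) * T
      + 8 * ?d * L * \<eta> * D 0 + 8 / 3 * L * \<eta> * (12 * ?d\<^sup>2 * L\<^sup>2 * \<alpha>\<^sup>2) * T"
  proof (rule sum_squared_gradients_bound[where G = G])
    show "F (Suc t) \<le> F t - \<eta> / 2 * (D t - L\<^sup>2 * \<alpha>\<^sup>2) + L * \<eta>\<^sup>2 / 2 * G t" if "1 \<le> t" "t \<le> T" for t
      unfolding F_def D_def G_def using that \<eta> by (intro expectation_descent) auto
    show "G (Suc t) \<le> G t / 4 + 3 * ?d * (D (Suc t) + D t) + 12 * ?d\<^sup>2 * L\<^sup>2 * \<alpha>\<^sup>2" if "Suc t \<le> T" for t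
      unfolding D_def G_def using that \<eta> by (intro expectation_estimate_recursion) auto
  qed (use \<eta> L in \<open>auto simp: D_def G_def estimate_0\<close>)
  have F1: "F 1 = f x1" by (simp add: F_def iterate_def prob_space)
  have "m = expectation (\<lambda>_. m)" by (simp add: prob_space)
  also have "\<dots> \<le> F (Suc T)"
    unfolding F_def by (intro integral_mono integrable_f_iterate min) auto
  finally have "4 * (F 1 - F (Suc T)) / \<eta> \<le> 4 * (f x1 - m) / \<eta>"
    unfolding F1 using \<eta> by (intro divide_right_mono) auto
  moreover have "D 0 \<le> L0\<^sup>2"
    unfolding D_def by (simp add: iterate_0 prob_space norm_gradient_le power_mono)
  then have "8 * ?d * L * \<eta> * D 0 \<le> 8 * ?d * L * \<eta> * L0\<^sup>2"
    using \<eta> L by (intro mult_left_mono) auto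
  moreover have "8 / 3 * L * \<eta> * (12 * ?d\<^sup>2 * L\<^sup>2 * \<alpha>\<^sup>2) * T = 32 * \<eta> * ?d\<^sup>2 * L ^ 3 * \<alpha>\<^sup>2 * T"
    by (simp add: power2_eq_square power3_eq_cube)
  ultimately show ?thesis using sum unfolding D_def mult.assoc by linarith
qed

theorem theorem9:
  fixes f :: "real ^ 'd \<Rightarrow> real"
    and xstar x1 :: "real ^ 'd"
    and d L0 L \<alpha> \<eta> :: real
    and T :: nat
    and M :: "'w measure"
    and u :: "nat \<Rightarrow> 'w \<Rightarrow> real ^ 'd"
  assumes "d = real CARD('d)"
    and "L0 > 0" and "L0-lipschitz_on UNIV f"
    and "L > 0" and "smooth_with L f"
    and "\<And>y. f xstar \<le> f y"
    and "T \<ge> 1"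
    and "\<alpha> > 0"
    and "\<eta> = min (\<alpha> / (4 * d * L0)) (1 / (16 * d * L))"
    and "prob_space M"
    and "prob_space.indep_vars M (\<lambda>_. borel) u {0..T}"
    and "\<And>t. t \<le> T \<Longrightarrow> distr M borel (u t) = uniform_sphere"
  shows "(1 / real T) * (\<Sum>t=1..T.
           prob_space.expectation M (\<lambda>\<omega>. (norm (gradient f (residual_iterate f \<alpha> \<eta> x1 (\<lambda>s. u s \<omega>) t)))\<^sup>2))
    \<le> 4 * (f x1 - f xstar) / (\<eta> * real T) + 4 * L * \<alpha>\<^sup>2 / (\<eta> * real T)
      + 32 * d * L * L0\<^sup>2 * \<eta> / real T + 40 * \<eta> * d\<^sup>2 * L ^ 3 * \<alpha>\<^sup>2 + 2 * L\<^sup>2 * \<alpha>\<^sup>2"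
proof -
  interpret prob_space M by fact
  interpret residual_feedback M f L0 L \<alpha> \<eta> x1 u T
    by unfold_locales (use assms in auto)
  have d: "real DIM(real ^ 'd) = d" "0 < d" using assms(1) by simp_all
  have T: "0 < real T" using \<open>T \<ge> 1\<close> by simp
  have \<eta>: "0 < \<eta>" "\<eta> \<le> \<alpha> / (4 * d * L0)" "\<eta> \<le> 1 / (16 * d * L)"
    using assms d by auto
  have "16 * d * L * \<eta> \<le> 1"
    using \<eta>(3) d \<open>L > 0\<close> by (simp add: pos_le_divide_eq mult_ac)
  moreover have "4 * d * L0 * \<eta> \<le> \<alpha>"
    using \<eta>(2) d \<open>L0 > 0\<close> by (simp add: pos_le_divide_eq mult_ac)
  then have "(4 * d * L0 * \<eta>)\<^sup>2 \<le> \<alpha>\<^sup>2"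
    using d \<open>L0 > 0\<close> \<eta>(1) by (intro power_mono) auto
  then have "16 * d\<^sup>2 * L0\<^sup>2 * \<eta>\<^sup>2 \<le> \<alpha>\<^sup>2" by (simp add: power_mult_distrib)
  ultimately have "(\<Sum>t=1..T. expectation (\<lambda>\<omega>. (norm (gradient f (iterate t \<omega>)))\<^sup>2))
    \<le> 4 * (f x1 - f xstar) / \<eta> + 2 * L\<^sup>2 * \<alpha>\<^sup>2 * T + 8 * d * L * \<eta> * L0\<^sup>2
      + 32 * \<eta> * d\<^sup>2 * L ^ 3 * \<alpha>\<^sup>2 * T"
    using sum_expected_squared_gradients[of "f xstar"] \<eta>(1) assms(6) unfolding d(1) by simp
  from divide_right_mono[OF this, of "real T"] T
  have "(1 / real T) * (\<Sum>t=1..T. expectation (\<lambda>\<omega>. (norm (gradient f (iterate t \<omega>)))\<^sup>2))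
    \<le> 4 * (f x1 - f xstar) / (\<eta> * real T) + 8 * d * L * L0\<^sup>2 * \<eta> / real T
      + 32 * \<eta> * d\<^sup>2 * L ^ 3 * \<alpha>\<^sup>2 + 2 * L\<^sup>2 * \<alpha>\<^sup>2"
    by (simp add: add_divide_distrib mult_ac)
  moreover have "0 \<le> 4 * L * \<alpha>\<^sup>2 / (\<eta> * real T)"
    using \<eta>(1) T \<open>L > 0\<close> by simp
  moreover have "8 * d * L * L0\<^sup>2 * \<eta> / real T \<le> 32 * d * L * L0\<^sup>2 * \<eta> / real T"
    using d \<eta>(1) T \<open>L > 0\<close> by (intro divide_right_mono mult_right_mono) auto
  moreover have "32 * \<eta> * d\<^sup>2 * L ^ 3 * \<alpha>\<^sup>2 \<le> 40 * \<eta> * d\<^sup>2 * L ^ 3 * \<alpha>\<^sup>2"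
    using d \<eta>(1) \<open>L > 0\<close> by (intro mult_right_mono) auto
  ultimately show ?thesis unfolding iterate_def by linarith
qed

end
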